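(* Let $p$ be an odd prime and let $f\colon\mathbb Z_p\to\mathbb Z_p$ be a compatible function with interpolation series $f(x)=\sum_{i\ge0}a_i\binom{x}{i}$ ($a_i\in\mathbb Z_p$) such that for some $\rho(f)\in\mathbb N_0$ one has $\|a_i/i!\|_p\le p^{\rho(f)}$ for all $i\ge0$. Put $\lambda(f)=\min\{k\in\mathbb N: 2\frac{p^k-1}{p-1}-k>\rho(f)\}$. Then $f$ is ergodic if and only if $f$ is transitive modulo $p^{\lambda(f)+1}$ (when $p\neq3$), respectively modulo $3^{\lambda(f)+2}$ (when $p=3$).
   Context: $\mathbb Z_p$ denotes the $p$-adic integers with norm $\|\cdot\|_p$, $\mathbb N_0=\{0,1,2,\dots\}$; $\binom{x}{i}=x(x-1)\cdots(x-i+1)/i!$. $f$ is compatible if $\|f(x)-f(y)\|_p\le\|x-y\|_p$ for all $x,y$. $f$ is transitive modulo $p^k$ if $x\mapsto f(x)\bmod p^k$ induces a single-cycle permutation of $\mathbb Z/p^k$. With $\mu$ the normalized Haar measure on $\mathbb Z_p$, $f$ is ergodic if $\mu(f^{-1}(U))=\mu(U)$ for all measurable $U$ and $f^{-1}(U)=U$ implies $\mu(U)\in\{0,1\}$; for compatible $f$ this is equivalent to $f$ being transitive modulo $p^k$ for every $k\ge1$. *)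

theory Defs
  imports
    "HOL-Probability.Probability"
    "HOL-Combinatorics.Orbits"
    "HOL-Computational_Algebra.Polynomial_Factorial"
    "Berlekamp_Zassenhaus.Finite_Field"
begin

section \<open>The ring of \<open>p\<close>-adic integers\<close>

text \<open>
  The prime is \<open>p = CARD('p)\<close> for a type \<open>'p\<close> of class \<open>prime_card\<close>, and
  \<open>\<int>\<^sub>p\<close> is the inverse limit of the rings \<open>\<int>/p\<^sup>n\<close>: an element is its sequence of
  residues, where \<open>padic_res x n\<close> is the representative of \<open>x\<close> modulo \<open>p\<^sup>n\<close> in \<open>{0..<p\<^sup>n}\<close>.
\<close>

typedef ('p::prime_card) padic_int =
  "{x :: nat \<Rightarrow> int. \<forall>n. x n \<in> {0..<int CARD('p) ^ n} \<and> x (Suc n) mod int CARD('p) ^ n = x n}"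
  morphisms padic_res Abs_padic_int
  by (rule exI[of _ "\<lambda>_. 0"]) auto

setup_lifting type_definition_padic_int

lemma CARD_prime: "prime (CARD('p::prime_card))"
  by (rule prime_card)

lemma CARD_prime_int: "prime (int CARD('p::prime_card))"
  using CARD_prime[where 'p='p] by simp

lemma CARD_gt_1: "CARD('p::prime_card) > 1"
  using CARD_prime[where 'p='p] by (rule prime_gt_1_nat)

lemma CARD_power_pos: "int CARD('p::prime_card) ^ n > 0"
  by simp

lemma coherentI:
  assumes "[c' = c] (mod int CARD('p::prime_card) ^ n)"
  shows "c mod int CARD('p) ^ n \<in> {0..<int CARD('p) ^ n} \<and>
    c' mod int CARD('p) ^ Suc n mod int CARD('p) ^ n = c mod int CARD('p) ^ n"
  using assms CARD_power_pos[where 'p='p and n=n]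
  by (auto simp: cong_def mod_mod_cancel)

lemma padic_res_cong_Suc:
  fixes x :: "'p::prime_card padic_int"
  shows "[padic_res x (Suc n) = padic_res x n] (mod int CARD('p) ^ n)"
  using padic_res[of x] by (auto simp: cong_def)

lemma padic_res_bounds:
  fixes x :: "'p::prime_card padic_int"
  shows "0 \<le> padic_res x n" "padic_res x n < int CARD('p) ^ n"
  using padic_res[of x] by auto

lemma padic_res_mod_self:
  fixes x :: "'p::prime_card padic_int"
  shows "padic_res x n mod int CARD('p) ^ n = padic_res x n"
  using padic_res_bounds[of x n] by simp

lemma padic_res_mod:
  fixes x :: "'p::prime_card padic_int"
  assumes "m \<le> n"
  shows "padic_res x n mod int CARD('p) ^ m = padic_res x m"
  using assms
proof (induction n rule: dec_induct)
  case base
  then show ?case by (rule padic_res_mod_self)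
next
  case (step n)
  have "padic_res x (Suc n) mod int CARD('p) ^ m
      = padic_res x (Suc n) mod int CARD('p) ^ n mod int CARD('p) ^ m"
    using step by (simp add: mod_mod_cancel le_imp_power_dvd)
  also have "\<dots> = padic_res x m"
    using padic_res_cong_Suc[of x n] step by (simp add: cong_def padic_res_mod_self)
  finally show ?case .
qed

lemma padic_eqI:
  fixes x y :: "'p::prime_card padic_int"
  shows "(\<And>n. padic_res x n = padic_res y n) \<Longrightarrow> x = y"
  by (metis padic_res_inject ext)

lemma ex_padic:
  assumes "\<And>n. [c (Suc n) = c n] (mod int CARD('p::prime_card) ^ n)"
  obtains x :: "'p::prime_card padic_int" where "\<And>n. padic_res x n = c n mod int CARD('p) ^ n"
proof -
  have "(\<lambda>n. c n mod int CARD('p) ^ n) \<in>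
      {x. \<forall>n. x n \<in> {0..<int CARD('p) ^ n} \<and> x (Suc n) mod int CARD('p) ^ n = x n}"
    using coherentI[OF assms] by simp
  from Abs_padic_int_inverse[OF this] show ?thesis using that by metis
qed

instantiation padic_int :: (prime_card) comm_ring_1
begin

lift_definition zero_padic_int :: "'a padic_int" is "\<lambda>n. 0" by auto

lift_definition one_padic_int :: "'a padic_int" is "\<lambda>n. 1 mod int CARD('a) ^ n"
  by (rule coherentI) auto

lift_definition plus_padic_int :: "'a padic_int \<Rightarrow> 'a padic_int \<Rightarrow> 'a padic_int"
  is "\<lambda>x y n. (x n + y n) mod int CARD('a) ^ n"
  by (rule coherentI, rule cong_add) (metis cong_def mod_mod_trivial)+

lift_definition minus_padic_int :: "'a padic_int \<Rightarrow> 'a padic_int \<Rightarrow> 'a padic_int"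
  is "\<lambda>x y n. (x n - y n) mod int CARD('a) ^ n"
  by (rule coherentI, rule cong_diff) (metis cong_def mod_mod_trivial)+

lift_definition uminus_padic_int :: "'a padic_int \<Rightarrow> 'a padic_int"
  is "\<lambda>x n. (- x n) mod int CARD('a) ^ n"
  by (rule coherentI, subst cong_minus_minus_iff) (metis cong_def mod_mod_trivial)

lift_definition times_padic_int :: "'a padic_int \<Rightarrow> 'a padic_int \<Rightarrow> 'a padic_int"
  is "\<lambda>x y n. (x n * y n) mod int CARD('a) ^ n"
  by (rule coherentI, rule cong_mult) (metis cong_def mod_mod_trivial)+

instance
proof
  fix a b c :: "'a padic_int"
  have *: "padic_res x n mod int CARD('a) ^ n = padic_res x n" for x :: "'a padic_int" and n
    by (rule padic_res_mod_self)
  note defs = zero_padic_int.rep_eq one_padic_int.rep_eq plus_padic_int.rep_eq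
    minus_padic_int.rep_eq uminus_padic_int.rep_eq times_padic_int.rep_eq
  show "a + b + c = a + (b + c)"
    by (rule padic_eqI) (simp add: defs mod_simps algebra_simps)
  show "a + b = b + a"
    by (rule padic_eqI) (simp add: defs mod_simps algebra_simps)
  show "0 + a = a"
    by (rule padic_eqI) (simp add: defs *)
  show "- a + a = 0"
    by (rule padic_eqI) (simp add: defs mod_simps)
  show "a - b = a + - b"
    by (rule padic_eqI) (simp add: defs mod_simps)
  show "a * b * c = a * (b * c)"
    by (rule padic_eqI) (simp add: defs mod_simps algebra_simps)
  show "a * b = b * a"
    by (rule padic_eqI) (simp add: defs mod_simps algebra_simps)
  show "1 * a = a"
    by (rule padic_eqI) (simp add: defs mod_simps *)
  show "(a + b) * c = a * c + b * c"
    by (rule padic_eqI) (simp add: defs mod_simps algebra_simps)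
  show "0 \<noteq> (1 :: 'a padic_int)"
  proof
    assume "0 = (1 :: 'a padic_int)"
    then have "padic_res (0 :: 'a padic_int) 1 = padic_res (1 :: 'a padic_int) 1" by simp
    then show False
      using CARD_gt_1[where 'p='a] by (simp add: defs)
  qed
qed

end

lemmas padic_res_simps =
  zero_padic_int.rep_eq one_padic_int.rep_eq plus_padic_int.rep_eq
  minus_padic_int.rep_eq uminus_padic_int.rep_eq times_padic_int.rep_eq

lemma padic_res_of_nat:
  "padic_res (of_nat m :: 'p::prime_card padic_int) n = int m mod int CARD('p) ^ n"
  by (induction m) (auto simp: padic_res_simps mod_simps add.commute)

lemma padic_res_diff_eq_0_iff:
  fixes x y :: "'p::prime_card padic_int"
  shows "padic_res (x - y) n = 0 \<longleftrightarrow> padic_res x n = padic_res y n"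
  by (metis minus_padic_int.rep_eq mod_eq_dvd_iff dvd_eq_mod_eq_0 padic_res_mod_self)

lemma padic_res_eq_mono:
  fixes x y :: "'p::prime_card padic_int"
  assumes "padic_res x n = padic_res y n" "m \<le> n"
  shows "padic_res x m = padic_res y m"
  using assms padic_res_mod by metis


section \<open>Norm and metric\<close>

text \<open>For \<open>x \<noteq> 0\<close>, \<open>padic_val x\<close> is the largest \<open>n\<close> such that \<open>p\<^sup>n\<close> divides \<open>x\<close>.\<close>

definition padic_val :: "'p::prime_card padic_int \<Rightarrow> nat" where
  "padic_val x = (LEAST n. padic_res x (Suc n) \<noteq> 0)"

definition pint_norm :: "'p::prime_card padic_int \<Rightarrow> real" where
  "pint_norm x = (if x = 0 then 0 else 1 / real CARD('p) ^ padic_val x)"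

lemma padic_val:
  fixes x :: "'p::prime_card padic_int"
  assumes "x \<noteq> 0"
  shows "padic_res x (Suc (padic_val x)) \<noteq> 0"
    and "padic_res x n = 0 \<longleftrightarrow> n \<le> padic_val x"
proof -
  have res0: "padic_res x 0 = 0"
    using padic_res_bounds[of x 0] by simp
  obtain k where k: "padic_res x k \<noteq> 0"
    using assms padic_eqI[of x 0] by (auto simp: padic_res_simps)
  then obtain k' where "k = Suc k'"
    using res0 by (cases k) auto
  with k have ex: "\<exists>n. padic_res x (Suc n) \<noteq> 0" by auto
  show 1: "padic_res x (Suc (padic_val x)) \<noteq> 0"
    unfolding padic_val_def by (rule LeastI_ex[OF ex])
  have 2: "padic_res x (padic_val x) = 0"
  proof (cases "padic_val x")
    case (Suc m)
    then have "m < padic_val x" by simp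
    then have "padic_res x (Suc m) = 0"
      unfolding padic_val_def using not_less_Least by blast
    then show ?thesis by (simp add: Suc)
  qed (simp add: res0)
  show "padic_res x n = 0 \<longleftrightarrow> n \<le> padic_val x"
    using padic_res_eq_mono[of x _ 0] 1 2
    by (metis not_less_eq_eq zero_padic_int.rep_eq)
qed

lemma padic_norm_nonneg: "pint_norm (x :: 'p::prime_card padic_int) \<ge> 0"
  by (simp add: pint_norm_def)

lemma padic_norm_eq_0_iff: "pint_norm (x :: 'p::prime_card padic_int) = 0 \<longleftrightarrow> x = 0"
  by (simp add: pint_norm_def)

lemma padic_norm_le_iff:
  fixes x :: "'p::prime_card padic_int"
  shows "pint_norm x \<le> 1 / real CARD('p) ^ n \<longleftrightarrow> padic_res x n = 0"
  using CARD_gt_1[where 'p='p]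
  by (cases "x = 0") (auto simp: pint_norm_def padic_res_simps padic_val field_simps)

lemma padic_norm_ultrametric:
  fixes x y :: "'p::prime_card padic_int"
  shows "pint_norm (x + y) \<le> max (pint_norm x) (pint_norm y)"
proof (cases "x = 0 \<or> y = 0")
  case False
  define n where "n = min (padic_val x) (padic_val y)"
  have "padic_res x n = 0" "padic_res y n = 0"
    using False by (simp_all add: padic_val n_def)
  then have "padic_res (x + y) n = 0"
    by (simp add: padic_res_simps)
  then have "pint_norm (x + y) \<le> 1 / real CARD('p) ^ n"
    by (simp add: padic_norm_le_iff)
  also have "\<dots> \<le> max (pint_norm x) (pint_norm y)"
    using False by (auto simp: pint_norm_def n_def min_def)
  finally show ?thesis .
qed (use padic_norm_nonneg[of x] padic_norm_nonneg[of y] in \<open>auto simp: max_def\<close>)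

lemma padic_norm_minus: "pint_norm (- x :: 'p::prime_card padic_int) = pint_norm x"
proof -
  have "padic_res (- x) n = 0 \<longleftrightarrow> padic_res x n = 0" for n
    using padic_res_diff_eq_0_iff[of 0 x n] by (auto simp: padic_res_simps)
  then show ?thesis
    by (simp add: pint_norm_def padic_val_def)
qed

instantiation padic_int :: (prime_card) metric_space
begin

definition dist_padic_int :: "'a padic_int \<Rightarrow> 'a padic_int \<Rightarrow> real" where
  "dist x y = pint_norm (x - y)"

definition uniformity_padic_int_def:
  "(uniformity :: ('a padic_int \<times> 'a padic_int) filter) = (INF e\<in>{0<..}. principal {(x, y). dist x y < e})"

definition open_padic_int_def:
  "open (U :: 'a padic_int set) \<longleftrightarrow> (\<forall>x\<in>U. \<forall>\<^sub>F (x', y) in uniformity. x' = x \<longrightarrow> y \<in> U)"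

instance
proof
  fix x y z :: "'a padic_int" and U :: "'a padic_int set"
  show "uniformity = (INF e\<in>{0<..}. principal {(x :: 'a padic_int, y). dist x y < e})"
    by (rule uniformity_padic_int_def)
  show "open U \<longleftrightarrow> (\<forall>x\<in>U. \<forall>\<^sub>F (x', y) in uniformity. x' = x \<longrightarrow> y \<in> U)"
    by (rule open_padic_int_def)
  show "dist x y = 0 \<longleftrightarrow> x = y"
    by (simp add: dist_padic_int_def padic_norm_eq_0_iff)
  have "pint_norm (x - y) \<le> max (pint_norm (x - z)) (pint_norm (- (y - z)))"
    using padic_norm_ultrametric[of "x - z" "- (y - z)"] by simp
  then show "dist x y \<le> dist x z + dist y z"
    unfolding dist_padic_int_def padic_norm_minus
    using padic_norm_nonneg[of "x - z"] padic_norm_nonneg[of "y - z"] by linarith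
qed

end

lemma padic_norm_mult:
  fixes x y :: "'p::prime_card padic_int"
  shows "pint_norm (x * y) = pint_norm x * pint_norm y"
proof (cases "x = 0 \<or> y = 0")
  case True
  then show ?thesis by (auto simp: pint_norm_def)
next
  case False
  define v w where "v = padic_val x" and "w = padic_val y"
  define P where "P = int CARD('p)"
  have P: "prime P" "P > 0" using CARD_prime_int[where 'p='p] by (simp_all add: P_def)
  define N where "N = Suc (v + w)"
  have "padic_res x N mod P ^ v = 0" "padic_res y N mod P ^ w = 0"
    using False by (simp_all add: P_def padic_res_mod N_def padic_val v_def w_def)
  then obtain a b where ab: "padic_res x N = P ^ v * a" "padic_res y N = P ^ w * b"
    by (metis dvd_def dvd_eq_mod_eq_0)
  have "padic_res x N mod P ^ Suc v \<noteq> 0" "padic_res y N mod P ^ Suc w \<noteq> 0"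
    using False padic_val(1)[of x] padic_val(1)[of y]
    by (simp_all add: P_def padic_res_mod N_def v_def w_def del: power_Suc)
  then have "\<not> P dvd a" "\<not> P dvd b"
    using ab by (auto simp: mult.commute)
  then have nd: "\<not> P dvd a * b"
    using P by (simp add: prime_dvd_mult_iff)
  have eq: "padic_res x N * padic_res y N = P ^ (v + w) * (a * b)"
    by (simp add: ab power_add algebra_simps)
  have 1: "padic_res (x * y) N \<noteq> 0"
  proof
    assume "padic_res (x * y) N = 0"
    then have "P ^ N dvd P ^ (v + w) * (a * b)"
      by (simp add: padic_res_simps eq P_def[symmetric] dvd_eq_mod_eq_0)
    then show False
      using nd P by (simp add: N_def)
  qed
  have "padic_res (x * y) (v + w) = padic_res (x * y) N mod P ^ (v + w)"
    by (simp add: P_def padic_res_mod N_def)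
  also have "\<dots> = P ^ (v + w) * (a * b) mod P ^ N mod P ^ (v + w)"
    by (simp add: padic_res_simps eq P_def[symmetric])
  also have "\<dots> = 0"
    by (simp add: mod_mod_cancel le_imp_power_dvd N_def)
  finally have 2: "padic_res (x * y) (v + w) = 0" .
  have nz: "x * y \<noteq> 0"
    using 1 zero_padic_int.rep_eq[where 'a='p] by metis
  have "padic_val (x * y) = v + w"
    using 1 2 padic_val(2)[OF nz] by (simp add: N_def)
  then show ?thesis
    using False nz by (simp add: pint_norm_def v_def w_def power_add)
qed

instance padic_int :: (prime_card) idom
proof
  fix a b :: "'a padic_int"
  assume "a \<noteq> 0" "b \<noteq> 0"
  then show "a * b \<noteq> 0"
    using padic_norm_mult[of a b] by (metis mult_eq_0_iff padic_norm_eq_0_iff)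
qed

instance padic_int :: (prime_card) ring_char_0
proof
  show "inj (of_nat :: nat \<Rightarrow> 'a padic_int)"
  proof (rule injI)
    fix m n :: nat
    assume eq: "of_nat m = (of_nat n :: 'a padic_int)"
    have lt: "int k < int CARD('a) ^ (m + n + 1)" if "k \<le> m + n" for k
    proof -
      have "k < 2 ^ (m + n + 1)"
        using that less_exp[of "m + n + 1"] by linarith
      also have "\<dots> \<le> CARD('a) ^ (m + n + 1)"
        using CARD_gt_1[where 'p='a] by (intro power_mono) auto
      finally show ?thesis
        by (metis of_nat_less_iff of_nat_power)
    qed
    have "int m mod int CARD('a) ^ (m + n + 1) = int n mod int CARD('a) ^ (m + n + 1)"
      using eq by (metis padic_res_of_nat)
    then show "m = n"
      using lt[of m] lt[of n] by simp
  qed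
qed

text \<open>Division is exact division in \<open>\<int>\<^sub>p\<close>; its value is only meaningful if \<open>b\<close> divides \<open>a\<close>.\<close>

instantiation padic_int :: (prime_card) semidom_divide
begin

definition divide_padic_int_def:
  "a div (b :: 'a padic_int) = (if b = 0 then 0 else (THE c. a = c * b))"

instance
  by standard (auto simp: divide_padic_int_def)

end


section \<open>Binomial coefficients\<close>

lemma padic_factor:
  fixes x :: "'p::prime_card padic_int"
  assumes "padic_res x v = 0"
  obtains y where "x = of_nat (CARD('p) ^ v) * y"
    and "\<And>n. padic_res x (n + v) = int CARD('p) ^ v * padic_res y n"
proof -
  define P where "P = int CARD('p)"
  have P: "P > 0" by (simp add: P_def)
  define c where "c n = padic_res x (n + v) div P ^ v" for n
  have "padic_res x (n + v) mod P ^ v = 0" for n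
    using assms padic_res_mod[of v "n + v" x] by (simp add: P_def)
  then have c: "padic_res x (n + v) = P ^ v * c n" for n
    unfolding c_def by (metis dvd_eq_mod_eq_0 dvd_mult_div_cancel)
  have cc: "[c (Suc n) = c n] (mod P ^ n)" for n
  proof -
    have "[P ^ v * c (Suc n) = P ^ v * c n] (mod P ^ v * P ^ n)"
      using padic_res_cong_Suc[of x "n + v"] c[of "Suc n"] c[of n]
      by (simp add: P_def power_add mult.commute)
    then show ?thesis
      using P by (simp add: cong_iff_dvd_diff flip: right_diff_distrib)
  qed
  have bd: "0 \<le> c n \<and> c n < P ^ n" for n
  proof -
    have "0 \<le> P ^ v * c n" "P ^ v * c n < P ^ v * P ^ n"
      using padic_res_bounds[of x "n + v"] c[of n]
      by (simp_all add: P_def power_add mult.commute)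
    moreover have "P ^ v > 0" using P by simp
    ultimately show ?thesis by (simp add: zero_le_mult_iff)
  qed
  obtain y :: "'p padic_int" where "\<And>n. padic_res y n = c n mod P ^ n"
    using ex_padic[of c] cc unfolding P_def by metis
  then have y: "padic_res y n = c n" for n using bd[of n] by simp
  have "x = of_nat (CARD('p) ^ v) * y"
  proof (rule padic_eqI)
    fix n
    have "padic_res (of_nat (CARD('p) ^ v) * y) n = (P ^ v * c n) mod P ^ n"
      by (simp add: padic_res_simps padic_res_of_nat y mod_simps P_def
          del: of_nat_power flip: of_nat_power)
    also have "\<dots> = padic_res x n"
      using padic_res_mod[of n "n + v" x] by (simp add: c P_def)
    finally show "padic_res x n = padic_res (of_nat (CARD('p) ^ v) * y) n" ..
  qed
  then show ?thesis using that c y unfolding P_def by simp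
qed

lemma padic_unit:
  fixes u :: "'p::prime_card padic_int"
  assumes "padic_res u 1 \<noteq> 0"
  obtains w where "u * w = 1"
proof -
  define P where "P = int CARD('p)"
  have P: "prime P" using CARD_prime_int[where 'p='p] by (simp add: P_def)
  have cop: "coprime (padic_res u n) (P ^ n)" for n
  proof (cases n)
    case (Suc m)
    have "padic_res u n mod P ^ 1 \<noteq> 0"
      using assms padic_res_mod[of 1 n u] Suc by (simp add: P_def)
    then have "\<not> P dvd padic_res u n" by auto
    then have "coprime P (padic_res u n)" using P by (simp add: prime_imp_coprime)
    then show ?thesis by (simp add: coprime_commute)
  qed simp
  then have "\<exists>c. [padic_res u n * c = 1] (mod P ^ n)" for n
    by (rule cong_solve_coprime_int)
  then obtain c where c: "[padic_res u n * c n = 1] (mod P ^ n)" for n by metis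
  have cc: "[c (Suc n) = c n] (mod P ^ n)" for n
  proof -
    have "[padic_res u (Suc n) * c (Suc n) = 1] (mod P ^ n)"
      by (rule cong_dvd_modulus[OF c[of "Suc n"]]) (simp add: P_def)
    moreover have "[padic_res u (Suc n) * c (Suc n) = padic_res u n * c (Suc n)] (mod P ^ n)"
      unfolding P_def by (intro cong_mult padic_res_cong_Suc) simp
    ultimately have "[padic_res u n * c (Suc n) = padic_res u n * c n] (mod P ^ n)"
      using c[of n] by (meson cong_sym cong_trans)
    then show ?thesis using cop[of n] by (simp add: cong_mult_lcancel)
  qed
  obtain w :: "'p padic_int" where w: "\<And>n. padic_res w n = c n mod P ^ n"
    using ex_padic[of c] cc unfolding P_def by metis
  have "u * w = 1"
    by (rule padic_eqI) (use c in \<open>simp add: padic_res_simps w mod_simps cong_def P_def\<close>)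
  then show ?thesis by (rule that)
qed

lemma padic_dvdI:
  fixes a b :: "'p::prime_card padic_int"
  assumes "pint_norm a \<le> pint_norm b"
  shows "b dvd a"
proof (cases "b = 0")
  case True
  then show ?thesis
    using assms padic_norm_nonneg[of a] padic_norm_eq_0_iff[of a] padic_norm_eq_0_iff[of b] by simp
next
  case False
  define v where "v = padic_val b"
  have "padic_res b v = 0" using False by (simp add: padic_val v_def)
  then obtain b' where b': "b = of_nat (CARD('p) ^ v) * b'"
    "\<And>n. padic_res b (n + v) = int CARD('p) ^ v * padic_res b' n"
    using padic_factor[of b v] by blast
  have "padic_res b' 1 \<noteq> 0"
    using b'(2)[of 1] padic_val(1)[OF False] by (auto simp: v_def)
  then obtain w where w: "b' * w = 1" by (rule padic_unit)
  have "padic_res a v = 0"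
    using assms False by (simp add: pint_norm_def[of b] v_def flip: padic_norm_le_iff)
  then obtain a' where a': "a = of_nat (CARD('p) ^ v) * a'"
    by (rule padic_factor)
  have "b * (w * a') = of_nat (CARD('p) ^ v) * (b' * w) * a'"
    by (simp add: b'(1) algebra_simps)
  also have "\<dots> = a" by (simp add: w a')
  finally show ?thesis by (metis dvd_triv_left)
qed

lemma padic_res_prod_cong:
  fixes g h :: "nat \<Rightarrow> 'p::prime_card padic_int"
  assumes "\<And>i. i < k \<Longrightarrow> padic_res (g i) n = padic_res (h i) n"
  shows "padic_res (\<Prod>i=0..<k. g i) n = padic_res (\<Prod>i=0..<k. h i) n"
  using assms by (induction k) (auto simp: padic_res_simps)

text \<open>\<open>k!\<close> divides \<open>x (x - 1) \<cdots> (x - k + 1)\<close> in \<open>\<int>\<^sub>p\<close>, so the division below is exact.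
  (The library's \<open>gchoose\<close> cannot be used here: its type is restricted to fields.)\<close>

definition padic_binom :: "'p::prime_card padic_int \<Rightarrow> nat \<Rightarrow> 'p padic_int" where
  "padic_binom x k = (\<Prod>i=0..<k. x - of_nat i) div fact k"

lemma padic_binom_mult_fact:
  fixes x :: "'p::prime_card padic_int"
  shows "padic_binom x k * fact k = (\<Prod>i=0..<k. x - of_nat i)"
proof -
  define v where "v = padic_val (fact k :: 'p padic_int)"
  define m where "m = nat (padic_res x v) + k * CARD('p) ^ v"
  have "k \<le> k * CARD('p) ^ v" by simp
  then have "k \<le> m" unfolding m_def by linarith
  then have le: "i < k \<Longrightarrow> i \<le> m" for i by simp
  have "padic_res x v = padic_res (of_nat m :: 'p padic_int) v"
    unfolding padic_res_of_nat m_def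
    using padic_res_bounds[of x v] padic_res_mod_self[of x v] by simp
  then have "padic_res (\<Prod>i=0..<k. x - of_nat i) v
      = padic_res (\<Prod>i=0..<k. of_nat m - of_nat i :: 'p padic_int) v"
    by (intro padic_res_prod_cong) (simp add: padic_res_simps)
  also have "(\<Prod>i=0..<k. of_nat m - of_nat i :: 'p padic_int) = of_nat (\<Prod>i=0..<k. m - i)"
    using le by (simp add: of_nat_diff)
  also have "(\<Prod>i=0..<k. m - i) = (m choose k) * fact k"
  proof -
    have "real (\<Prod>i=0..<k. m - i) = (\<Prod>i=0..<k. real m - real i)"
      using le by (simp add: of_nat_diff)
    also have "\<dots> = real ((m choose k) * fact k)"
      using gbinomial_mult_fact'[of "real m" k] by (simp add: binomial_gbinomial)
    finally show ?thesis by (simp only: of_nat_eq_iff)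
  qed
  also have "padic_res (of_nat ((m choose k) * fact k) :: 'p padic_int) v = 0"
    using padic_val(2)[of "fact k :: 'p padic_int" v]
    by (simp add: padic_res_simps v_def)
  finally have "pint_norm (\<Prod>i=0..<k. x - of_nat i) \<le> pint_norm (fact k :: 'p padic_int)"
    by (simp add: pint_norm_def[of "fact k"] v_def flip: padic_norm_le_iff)
  then obtain c where c: "(\<Prod>i=0..<k. x - of_nat i) = fact k * c"
    using padic_dvdI by (metis dvd_def)
  then show ?thesis
    by (simp add: padic_binom_def)
qed


section \<open>The field of \<open>p\<close>-adic numbers\<close>

type_synonym 'p padic = "'p padic_int fract"

definition padic_norm :: "'p::prime_card padic \<Rightarrow> real" where
  "padic_norm q = (THE r. \<exists>a b. b \<noteq> 0 \<and> q = Fract a b \<and> r = pint_norm a / pint_norm b)"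

lemma padic_norm_Fract:
  assumes "b \<noteq> 0"
  shows "padic_norm (Fract a b) = pint_norm a / pint_norm b"
  unfolding padic_norm_def
proof (rule the_equality)
  fix r
  assume "\<exists>c d. d \<noteq> 0 \<and> Fract a b = Fract c d \<and> r = pint_norm c / pint_norm d"
  then obtain c d where *: "d \<noteq> 0" "Fract a b = Fract c d" "r = pint_norm c / pint_norm d"
    by blast
  then have "a * d = c * b" using assms by (simp add: eq_fract)
  then have "pint_norm a * pint_norm d = pint_norm c * pint_norm b"
    by (metis padic_norm_mult)
  then show "r = pint_norm a / pint_norm b"
    using * assms padic_norm_eq_0_iff[of b] padic_norm_eq_0_iff[of d]
    by (simp add: frac_eq_eq)
qed (use assms in blast)


section \<open>Haar measure\<close>

definition normalized_haar :: "'p::prime_card padic_int measure \<Rightarrow> bool" where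
  "normalized_haar M \<longleftrightarrow> sets M = sets borel \<and> emeasure M UNIV = 1 \<and>
     (\<forall>A\<in>sets borel. \<forall>x. emeasure M ((+) x ` A) = emeasure M A)"

definition padic_haar :: "'p::prime_card padic_int measure" where
  "padic_haar = (THE M. normalized_haar M)"

definition padic_cyl :: "nat \<Rightarrow> int \<Rightarrow> 'p::prime_card padic_int set" where
  "padic_cyl n r = {x. padic_res x n = r}"

lemma dist_padic_le_iff:
  fixes x y :: "'p::prime_card padic_int"
  shows "dist x y \<le> 1 / real CARD('p) ^ n \<longleftrightarrow> padic_res x n = padic_res y n"
  by (simp add: dist_padic_int_def padic_norm_le_iff padic_res_diff_eq_0_iff)

lemma open_padic_cyl: "open (padic_cyl n r :: 'p::prime_card padic_int set)"
  unfolding open_dist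
proof
  fix x :: "'p padic_int"
  assume x: "x \<in> padic_cyl n r"
  have "y \<in> padic_cyl n r" if "dist y x < 1 / real CARD('p) ^ n" for y
    using that x dist_padic_le_iff[of y x n] by (simp add: padic_cyl_def)
  then show "\<exists>e>0. \<forall>y. dist y x < e \<longrightarrow> y \<in> padic_cyl n r"
    by (intro exI[of _ "1 / real CARD('p) ^ n"]) auto
qed

lemma open_padic_Union_cyl:
  fixes U :: "'p::prime_card padic_int set"
  assumes "open U"
  shows "U = (\<Union>(n, r)\<in>{(n, r). padic_cyl n r \<subseteq> U}. padic_cyl n r)"
proof (intro equalityI subsetI)
  fix x assume "x \<in> U"
  then obtain e where e: "e > 0" "\<And>y. dist y x < e \<Longrightarrow> y \<in> U"
    using assms unfolding open_dist by blast
  have "1 / real CARD('p) < 1"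
    using CARD_gt_1[where 'p='p] by simp
  then obtain n where n: "(1 / real CARD('p)) ^ n < e"
    using real_arch_pow_inv[OF e(1)] by blast
  have "padic_cyl n (padic_res x n) \<subseteq> U"
  proof
    fix y :: "'p padic_int" assume "y \<in> padic_cyl n (padic_res x n)"
    then have "dist y x \<le> 1 / real CARD('p) ^ n"
      by (simp add: dist_padic_le_iff padic_cyl_def)
    then show "y \<in> U" using n e(2)[of y] by (simp add: power_one_over)
  qed
  then show "x \<in> (\<Union>(n, r)\<in>{(n, r). padic_cyl n r \<subseteq> U}. padic_cyl n r)"
    by (auto simp: padic_cyl_def)
qed auto

lemma sets_borel_padic:
  "sets (borel :: 'p::prime_card padic_int measure)
    = sigma_sets UNIV (range (\<lambda>(n, r). padic_cyl n r))"
proof -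
  have "sigma_sets UNIV {S :: 'p padic_int set. open S}
      = sigma_sets UNIV (range (\<lambda>(n, r). padic_cyl n r))"
  proof (rule sigma_sets_eqI)
    fix U :: "'p padic_int set"
    assume "U \<in> {S. open S}"
    then have U: "U = (\<Union>(n, r)\<in>{(n, r). padic_cyl n r \<subseteq> U}. padic_cyl n r)"
      using open_padic_Union_cyl by blast
    interpret sigma_algebra UNIV
      "sigma_sets UNIV (range (\<lambda>(n, r). padic_cyl n r :: 'p padic_int set))"
      by (rule sigma_algebra_sigma_sets) simp
    show "U \<in> sigma_sets UNIV (range (\<lambda>(n, r). padic_cyl n r))"
      by (subst U, rule countable_UN'') auto
  qed (use open_padic_cyl in auto)
  then show ?thesis
    by (simp add: borel_def)
qed

lemma padic_cyl_eq_empty: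
  assumes "r \<notin> {0..<int CARD('p) ^ n}"
  shows "padic_cyl n r = ({} :: 'p::prime_card padic_int set)"
  using assms padic_res_bounds by (auto simp: padic_cyl_def)

lemma padic_cyl_0: "padic_cyl 0 0 = (UNIV :: 'p::prime_card padic_int set)"
proof -
  have "padic_res x 0 = 0" for x :: "'p padic_int"
    using padic_res_bounds[of x 0] by simp
  then show ?thesis by (auto simp: padic_cyl_def)
qed

lemma Int_stable_padic_cyl:
  "Int_stable (range (\<lambda>(n, r). padic_cyl n r :: 'p::prime_card padic_int set))"
proof -
  have *: "padic_cyl m r \<inter> padic_cyl n s \<in> range (\<lambda>(n, r). padic_cyl n r :: 'p padic_int set)"
    if "m \<le> n" for m n r s
  proof (cases "s mod int CARD('p) ^ m = r")
    case True
    then have "padic_cyl m r \<inter> padic_cyl n s = (padic_cyl n s :: 'p padic_int set)"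
      using padic_res_mod[OF that, where 'p='p] by (auto simp: padic_cyl_def)
    then show ?thesis by auto
  next
    case False
    then have "padic_cyl m r \<inter> padic_cyl n s = ({} :: 'p padic_int set)"
      using padic_res_mod[OF that, where 'p='p] by (auto simp: padic_cyl_def)
    also have "\<dots> = padic_cyl 0 1"
      by (subst padic_cyl_eq_empty) auto
    finally show ?thesis by auto
  qed
  show ?thesis
  proof (rule Int_stableI)
    fix A B :: "'p padic_int set"
    assume "A \<in> range (\<lambda>(n, r). padic_cyl n r)" "B \<in> range (\<lambda>(n, r). padic_cyl n r)"
    then obtain m r n s where "A = padic_cyl m r" "B = padic_cyl n s" by auto
    then show "A \<inter> B \<in> range (\<lambda>(n, r). padic_cyl n r)"
      using *[of m n r s] *[of n m s r] by (cases "m \<le> n") (auto simp: Int_commute)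
  qed
qed

lemma padic_measure_eqI:
  fixes M N :: "'p::prime_card padic_int measure"
  assumes "sets M = sets borel" "sets N = sets borel" "emeasure M UNIV \<noteq> \<infinity>"
    and "\<And>n r. r \<in> {0..<int CARD('p) ^ n} \<Longrightarrow> emeasure M (padic_cyl n r) = emeasure N (padic_cyl n r)"
  shows "M = N"
proof (rule measure_eqI_generator_eq[OF Int_stable_padic_cyl, where \<Omega> = UNIV and A = "\<lambda>_. UNIV"])
  show "range (\<lambda>(n, r). padic_cyl n r) \<subseteq> Pow (UNIV :: 'p padic_int set)" by simp
  show "sets M = sigma_sets UNIV (range (\<lambda>(n, r). padic_cyl n r))"
    "sets N = sigma_sets UNIV (range (\<lambda>(n, r). padic_cyl n r))"
    using assms sets_borel_padic by auto
  fix X :: "'p padic_int set"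
  assume "X \<in> range (\<lambda>(n, r). padic_cyl n r)"
  then obtain n r where X: "X = padic_cyl n r" by auto
  show "emeasure M X = emeasure N X"
    using assms(4)[of r n] padic_cyl_eq_empty[of r n, where 'p='p]
    by (cases "r \<in> {0..<int CARD('p) ^ n}") (auto simp: X)
next
  show "range (\<lambda>_. UNIV) \<subseteq> range (\<lambda>(n, r). padic_cyl n r :: 'p padic_int set)"
    by (auto simp: image_iff intro!: exI[of _ 0] padic_cyl_0[symmetric])
qed (use assms in auto)

lemma padic_cyl_translate:
  fixes x :: "'p::prime_card padic_int"
  assumes "r \<in> {0..<int CARD('p) ^ n}"
  shows "(+) x ` padic_cyl n r = padic_cyl n ((padic_res x n + r) mod int CARD('p) ^ n)"
proof (intro equalityI subsetI)
  fix z :: "'p padic_int" assume z: "z \<in> padic_cyl n ((padic_res x n + r) mod int CARD('p) ^ n)"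
  have "padic_res (z - x) n = r mod int CARD('p) ^ n"
    using z by (simp add: padic_cyl_def padic_res_simps mod_simps)
  then have "z - x \<in> padic_cyl n r"
    using assms by (simp add: padic_cyl_def)
  then show "z \<in> (+) x ` padic_cyl n r"
    by (intro image_eqI[of _ _ "z - x"]) auto
qed (auto simp: padic_cyl_def padic_res_simps)

lemma normalized_haar_cyl:
  fixes M :: "'p::prime_card padic_int measure"
  assumes "normalized_haar M" "r \<in> {0..<int CARD('p) ^ n}"
  shows "emeasure M (padic_cyl n r) = 1 / of_nat (CARD('p) ^ n)"
proof -
  have M: "sets M = sets borel" "emeasure M UNIV = 1"
    "\<And>A x. A \<in> sets borel \<Longrightarrow> emeasure M ((+) x ` A) = emeasure M A"
    using assms by (auto simp: normalized_haar_def)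
  have meas: "padic_cyl n s \<in> sets (borel :: 'p padic_int measure)" for s
    using open_padic_cyl by (rule borel_open)
  define q where "q = CARD('p) ^ n"
  have q: "q > 0" by (simp add: q_def)
  have eq: "emeasure M (padic_cyl n s) = emeasure M (padic_cyl n 0)"
    if s: "s \<in> {0..<int CARD('p) ^ n}" for s
  proof -
    have "(+) (of_nat (nat s)) ` padic_cyl n 0 = (padic_cyl n s :: 'p padic_int set)"
      using s by (subst padic_cyl_translate) (simp_all add: padic_res_of_nat del: of_nat_nat)
    then show ?thesis using M(3)[OF meas] by metis
  qed
  have U: "(UNIV :: 'p padic_int set) = (\<Union>s\<in>{0..<int q}. padic_cyl n s)"
    using padic_res_bounds by (auto simp: padic_cyl_def q_def)
  have "1 = emeasure M (\<Union>s\<in>{0..<int q}. padic_cyl n s)"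
    using M(2) U by simp
  also have "\<dots> = (\<Sum>s\<in>{0..<int q}. emeasure M (padic_cyl n s))"
    by (rule sum_emeasure[symmetric])
      (use M meas in \<open>auto simp: disjoint_family_on_def padic_cyl_def\<close>)
  also have "\<dots> = (\<Sum>s\<in>{0..<int q}. emeasure M (padic_cyl n 0))"
    by (intro sum.cong refl eq) (simp add: q_def)
  also have "\<dots> = of_nat q * emeasure M (padic_cyl n 0)"
    by simp
  finally have *: "of_nat q * emeasure M (padic_cyl n 0) = 1" ..
  have "emeasure M (padic_cyl n 0) = emeasure M (padic_cyl n 0) * of_nat q / of_nat q"
    using q by (intro ennreal_mult_divide_eq[symmetric]) auto
  also have "\<dots> = 1 / of_nat q"
    using * by (simp add: mult.commute)
  finally have "emeasure M (padic_cyl n 0) = 1 / of_nat q" .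
  then show ?thesis
    using eq[OF assms(2)] by (simp add: q_def)
qed

lemma digits_eq_iff:
  fixes P :: int
  assumes "P > 0" "r \<in> {0..<P ^ n}"
  shows "(\<Sum>i<n. (d i mod P) * P ^ i) = r \<longleftrightarrow> (\<forall>i<n. d i mod P = r div P ^ i mod P)"
  using assms(2)
proof (induction n arbitrary: r)
  case (Suc n)
  define S where "S = (\<Sum>i<n. (d i mod P) * P ^ i)"
  have S: "0 \<le> S \<and> S < P ^ n"
    unfolding S_def
  proof (induction n)
    case (Suc n)
    have "(d n mod P) * P ^ n \<le> (P - 1) * P ^ n"
      using assms(1) pos_mod_bound[of P "d n"] by (intro mult_right_mono) auto
    then show ?case using Suc assms(1) by (auto simp: algebra_simps)
  qed simp
  have r: "0 \<le> r" "r < P ^ n * P" using Suc.prems by (auto simp: mult.commute)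
  have rd: "r div P ^ n mod P = r div P ^ n"
  proof -
    have "r div P ^ n < P"
    proof (rule ccontr)
      assume "\<not> r div P ^ n < P"
      then have "P ^ n * P \<le> P ^ n * (r div P ^ n)"
        using assms(1) by (intro mult_left_mono) auto
      also have "\<dots> \<le> r"
      proof -
        have "0 \<le> r mod P ^ n" using assms(1) by simp
        then show ?thesis using mult_div_mod_eq[of "P ^ n" r] by linarith
      qed
      finally show False using r by simp
    qed
    then show ?thesis using r assms(1) by (simp add: pos_imp_zdiv_nonneg_iff)
  qed
  have "S + (d n mod P) * P ^ n = r \<longleftrightarrow> S = r mod P ^ n \<and> d n mod P = r div P ^ n"
  proof
    assume *: "S + (d n mod P) * P ^ n = r"
    show "S = r mod P ^ n \<and> d n mod P = r div P ^ n"
      using S assms(1) by (auto simp: *[symmetric])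
  next
    assume "S = r mod P ^ n \<and> d n mod P = r div P ^ n"
    then show "S + (d n mod P) * P ^ n = r" using mod_div_mult_eq[of r "P ^ n"] by presburger
  qed
  also have "S = r mod P ^ n \<longleftrightarrow> (\<forall>i<n. d i mod P = r mod P ^ n div P ^ i mod P)"
    unfolding S_def using assms(1) by (intro Suc.IH) auto
  also have "\<dots> \<longleftrightarrow> (\<forall>i<n. d i mod P = r div P ^ i mod P)"
  proof -
    have "r mod P ^ n div P ^ i mod P = r div P ^ i mod P" if "i < n" for i
    proof -
      have "P ^ n = P ^ i * (P * P ^ (n - i - 1))"
        using that by (metis Suc_diff_Suc add_diff_inverse_nat diff_Suc_1 diff_diff_left
            less_imp_le_nat not_less plus_1_eq_Suc power_Suc power_add add.commute)
      then have "r mod P ^ n = P ^ i * (r div P ^ i mod (P * P ^ (n - i - 1))) + r mod P ^ i"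
        using assms(1) by (simp add: zmod_zmult2_eq)
      then have "r mod P ^ n div P ^ i = r div P ^ i mod (P * P ^ (n - i - 1))"
        using assms(1) by simp
      then show ?thesis by (simp add: mod_mod_cancel)
    qed
    then show ?thesis by simp
  qed
  finally show ?case
    by (auto simp: S_def rd less_Suc_eq)
qed simp

lemma ex_padic_digit_measure:
  obtains M :: "'p::prime_card padic_int measure" where "sets M = sets borel"
    and "\<And>n r. r \<in> {0..<int CARD('p) ^ n} \<Longrightarrow>
      emeasure M (padic_cyl n r) = 1 / of_nat (CARD('p) ^ n)"
proof -
  define P where "P = int CARD('p)"
  have P_pos: "P > 0" by (simp add: P_def)
  define D where "D = (\<Pi>\<^sub>M i\<in>(UNIV :: nat set). measure_pmf (pmf_of_set {0..<P}))"
  interpret product_prob_space "\<lambda>_ :: nat. measure_pmf (pmf_of_set {0..<P})" UNIV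
    by unfold_locales
  have "\<exists>x :: 'p padic_int. \<forall>n. padic_res x n = (\<Sum>i<n. (d i mod P) * P ^ i) mod P ^ n"
    for d :: "nat \<Rightarrow> int"
    using ex_padic[of "\<lambda>n. \<Sum>i<n. (d i mod P) * P ^ i", where 'p='p]
    unfolding P_def by (auto simp: cong_def)
  then obtain \<phi> :: "(nat \<Rightarrow> int) \<Rightarrow> 'p padic_int"
    where \<phi>: "\<And>d n. padic_res (\<phi> d) n = (\<Sum>i<n. (d i mod P) * P ^ i) mod P ^ n"
    by metis
  have bd: "(\<Sum>i<n. (d i mod P) * P ^ i) \<in> {0..<P ^ n}" for d n
  proof (induction n)
    case (Suc n)
    have "(d n mod P) * P ^ n \<le> (P - 1) * P ^ n"
      using P_pos pos_mod_bound[of P "d n"] by (intro mult_right_mono) auto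
    moreover have "0 \<le> (d n mod P) * P ^ n" using P_pos by simp
    ultimately show ?case using Suc by (auto simp: algebra_simps)
  qed simp
  have pre: "\<phi> -` padic_cyl n r = {d\<in>space D. \<forall>i\<in>{..<n}. d i \<in> {z. z mod P = r div P ^ i mod P}}"
    if "r \<in> {0..<P ^ n}" for n r
    using digits_eq_iff[OF P_pos that] bd[of _ n]
    by (auto simp: padic_cyl_def \<phi> D_def space_PiM)
  have D_meas: "{d\<in>space D. \<forall>i\<in>{..<n}. d i \<in> X i} \<in> sets D" for n :: nat and X
    unfolding D_def by measurable
  have spD: "space D = UNIV" by (simp add: D_def space_PiM)
  have \<phi>_meas: "\<phi> \<in> measurable D borel"
  proof (rule measurable_sigma_sets[OF sets_borel_padic])
    fix A :: "'p padic_int set"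
    assume "A \<in> range (\<lambda>(n, r). padic_cyl n r)"
    then obtain n r where A: "A = padic_cyl n r" by auto
    show "\<phi> -` A \<inter> space D \<in> sets D"
    proof (cases "r \<in> {0..<P ^ n}")
      case True
      then show ?thesis using D_meas pre[OF True] by (simp only: A sets.Int sets.top)
    next
      case False
      then show ?thesis using padic_cyl_eq_empty[of r n, where 'p='p] by (auto simp: A P_def)
    qed
  qed (auto simp: spD)
  show ?thesis
  proof (rule that[of "distr D borel \<phi>"])
    fix n r assume r: "r \<in> {0..<int CARD('p) ^ n}"
    have "emeasure (distr D borel \<phi>) (padic_cyl n r) = emeasure D (\<phi> -` padic_cyl n r \<inter> space D)"
      by (rule emeasure_distr[OF \<phi>_meas]) (rule borel_open[OF open_padic_cyl])
    also have "\<phi> -` padic_cyl n r \<inter> space D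
        = {d\<in>space D. \<forall>i\<in>{..<n}. d i \<in> {z. z mod P = r div P ^ i mod P}}"
      using pre[of r n] r by (auto simp: P_def)
    also have "emeasure D \<dots> =
        (\<Prod>i<n. emeasure (measure_pmf (pmf_of_set {0..<P})) {z. z mod P = r div P ^ i mod P})"
      unfolding D_def by (rule emeasure_PiM_Collect) auto
    also have "\<dots> = (\<Prod>i<n. 1 / of_nat CARD('p))"
    proof (rule prod.cong[OF refl])
      fix i
      have "{0..<P} \<inter> {z. z mod P = r div P ^ i mod P} = {r div P ^ i mod P}"
        using P_pos by auto
      then show "emeasure (measure_pmf (pmf_of_set {0..<P})) {z. z mod P = r div P ^ i mod P}
          = 1 / of_nat CARD('p)"
        using P_pos divide_ennreal[of 1 "real CARD('p)"]
        by (subst emeasure_pmf_of_set) (auto simp: P_def ennreal_of_nat_eq_real_of_nat)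
    qed
    also have "\<dots> = 1 / of_nat (CARD('p) ^ n)"
      by (simp add: divide_ennreal_def ennreal_inverse_power)
    finally show "emeasure (distr D borel \<phi>) (padic_cyl n r) = 1 / of_nat (CARD('p) ^ n)" .
  qed simp
qed

lemma ex1_normalized_haar: "\<exists>!M :: 'p::prime_card padic_int measure. normalized_haar M"
proof (rule ex_ex1I)
  obtain M :: "'p padic_int measure" where M: "sets M = sets borel"
    "\<And>n r. r \<in> {0..<int CARD('p) ^ n} \<Longrightarrow>
      emeasure M (padic_cyl n r) = 1 / of_nat (CARD('p) ^ n)"
    using ex_padic_digit_measure by blast
  have 1: "emeasure M UNIV = 1"
    using M(2)[of 0 0] by (simp add: padic_cyl_0)
  have "emeasure M ((+) x ` A) = emeasure M A" if A: "A \<in> sets borel" for A x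
  proof -
    have "continuous_on UNIV ((+) (- x))"
      by (auto simp: continuous_on_iff dist_padic_int_def)
    then have meas: "(+) (- x) \<in> measurable M borel"
      using borel_measurable_continuous_onI measurable_cong_sets[OF M(1) refl] by blast
    have pre: "(+) (- x) -` B = (+) x ` B" for B
      by (auto simp: image_iff intro!: bexI[of _ "_ - x"])
    have spM: "space M = UNIV" using sets_eq_imp_space_eq[OF M(1)] by simp
    have em: "emeasure (distr M borel ((+) (- x))) B = emeasure M ((+) x ` B)"
      if "B \<in> sets borel" for B
      using emeasure_distr[OF meas that] by (simp add: pre spM)
    have "M = distr M borel ((+) (- x))"
    proof (rule padic_measure_eqI)
      fix n r assume r: "r \<in> {0..<int CARD('p) ^ n}"
      have "emeasure (distr M borel ((+) (- x))) (padic_cyl n r)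
          = emeasure M (padic_cyl n ((padic_res x n + r) mod int CARD('p) ^ n))"
        using em[of "padic_cyl n r"] r by (simp add: padic_cyl_translate borel_open open_padic_cyl)
      also have "\<dots> = emeasure M (padic_cyl n r)"
        using M(2)[OF r] by (subst M(2)) auto
      finally show "emeasure M (padic_cyl n r)
          = emeasure (distr M borel ((+) (- x))) (padic_cyl n r)" ..
    qed (use M 1 in auto)
    then show ?thesis using em[OF A] by simp
  qed
  then show "\<exists>M :: 'p padic_int measure. normalized_haar M"
    using M(1) 1 unfolding normalized_haar_def by blast
next
  fix M N :: "'p padic_int measure"
  assume "normalized_haar M" "normalized_haar N"
  then show "M = N"
    by (intro padic_measure_eqI) (auto simp: normalized_haar_cyl normalized_haar_def)
qed

lemma normalized_haar_padic_haar: "normalized_haar padic_haar"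
  unfolding padic_haar_def by (rule theI'[OF ex1_normalized_haar])


section \<open>Dynamics on \<open>\<int>\<^sub>p\<close>\<close>

definition compatible :: "('p::prime_card padic_int \<Rightarrow> 'p padic_int) \<Rightarrow> bool" where
  "compatible f \<longleftrightarrow> (\<forall>x y. pint_norm (f x - f y) \<le> pint_norm (x - y))"

text \<open>\<open>\<int>/p\<^sup>k\<close> is represented by \<open>{0..<p\<^sup>k}\<close>; \<open>g\<close> is the map induced by \<open>f\<close> on it.\<close>

definition transitive_mod :: "('p::prime_card padic_int \<Rightarrow> 'p padic_int) \<Rightarrow> nat \<Rightarrow> bool" where
  "transitive_mod f k \<longleftrightarrow>
     (\<exists>g. (\<forall>x. padic_res (f x) k = g (padic_res x k)) \<and>
          bij_betw g {0..<int CARD('p) ^ k} {0..<int CARD('p) ^ k} \<and>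
          cyclic_on g {0..<int CARD('p) ^ k})"

definition ergodic :: "('p::prime_card padic_int \<Rightarrow> 'p padic_int) \<Rightarrow> bool" where
  "ergodic f \<longleftrightarrow>
     f \<in> measurable padic_haar padic_haar \<and>
     (\<forall>U\<in>sets padic_haar. emeasure padic_haar (f -` U) = emeasure padic_haar U) \<and>
     (\<forall>U\<in>sets padic_haar. f -` U = U \<longrightarrow> emeasure padic_haar U \<in> {0, 1})"

definition lambda_bound :: "nat \<Rightarrow> nat \<Rightarrow> nat" where
  "lambda_bound p \<rho> =
     (LEAST k. k \<ge> 1 \<and> 2 * ((real p ^ k - 1) / (real p - 1)) - real k > real \<rho>)"

end

theory Submission
  imports Defs "HOL-Number_Theory.Residues"
begin

text \<open>
  A compatible \<open>f\<close> is ergodic iff all its reductions modulo \<open>p\<^sup>k\<close> are single cycles, so it suffices to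
  lift transitivity from \<open>p\<^sup>n\<^sup>+\<^sup>1\<close> to \<open>p\<^sup>n\<^sup>+\<^sup>2\<close>. Compatibility forces \<open>p\<^sup>s\<close> to divide the forward
  differences of order \<open>j \<ge> p\<^sup>s\<close>, and the bound on \<open>a\<^sub>i / i!\<close> together with \<open>n \<ge> \<lambda>(f)\<close> improves this to
  \<open>p\<^sup>n\<^sup>+\<^sup>1\<close> for \<open>j \<ge> 2 p\<^sup>n\<close> and to \<open>p\<^sup>n\<^sup>+\<^sup>2\<close> for \<open>j \<ge> 3 p\<^sup>n\<close>. By Newton's formula the second difference of
  \<open>f\<close> with step \<open>p\<^sup>n\<close> vanishes modulo \<open>p\<^sup>n\<^sup>+\<^sup>1\<close> and the third modulo \<open>p\<^sup>n\<^sup>+\<^sup>2\<close>, hence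
  \<open>f (x + p\<^sup>n t) \<equiv> f x + p\<^sup>n (A t + p B t\<^sup>2)\<close> modulo \<open>p\<^sup>n\<^sup>+\<^sup>2\<close>. This form is stable under composition, so it
  holds for the \<open>p\<^sup>n\<close>-th iterate \<open>G\<close> of \<open>f\<close>, where transitivity modulo \<open>p\<^sup>n\<^sup>+\<^sup>1\<close> gives \<open>G 0 = p\<^sup>n b\<close> with a
  unit \<open>b\<close> and \<open>A \<equiv> 1\<close> modulo \<open>p\<close>. Iterating, \<open>G\<^sup>j 0 \<equiv> p\<^sup>n j b\<close> modulo \<open>p\<^sup>n\<^sup>+\<^sup>2\<close> whenever \<open>p\<close> divides \<open>j\<close>, because
  \<open>p\<close> then divides \<open>\<Sum>i<j. i\<close> and, unless \<open>p = 3\<close>, also \<open>\<Sum>i<j. i\<^sup>2\<close>. For \<open>p = 3\<close> one more power of \<open>p\<close>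
  makes \<open>B\<close> divisible by \<open>p\<close>.
\<close>

subsection \<open>Divisibility by powers of the prime\<close>

text \<open>Norm bounds and equalities of residues are all rephrased as divisibility by powers of
  this element, so that the later estimates become ring identities and \<open>dvd\<close>
  rules.\<close>

definition padic_p :: "'p::prime_card padic_int" ("\<varpi>")
  where "\<varpi> = of_nat CARD('p)"

lemma padic_p_power_dvd_iff:
  fixes x :: "'p::prime_card padic_int"
  shows "\<varpi> ^ k dvd x \<longleftrightarrow> padic_res x k = 0"
proof
  assume "\<varpi> ^ k dvd x"
  then obtain y where "x = of_nat (CARD('p) ^ k) * y"
    by (auto simp: padic_p_def elim: dvdE)
  then show "padic_res x k = 0"
    by (simp add: padic_res_simps padic_res_of_nat del: of_nat_power flip: of_nat_power)
next
  assume "padic_res x k = 0"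
  then obtain y where "x = of_nat (CARD('p) ^ k) * y" by (rule padic_factor)
  then show "\<varpi> ^ k dvd x" by (simp add: padic_p_def)
qed

lemma padic_p_power_dvd_diff_iff:
  fixes x y :: "'p::prime_card padic_int"
  shows "\<varpi> ^ k dvd x - y \<longleftrightarrow> padic_res x k = padic_res y k"
  by (simp add: padic_p_power_dvd_iff padic_res_diff_eq_0_iff)

lemma padic_p_power_dvd_diff_commute:
  fixes x y :: "'p::prime_card padic_int"
  shows "\<varpi> ^ k dvd x - y \<longleftrightarrow> \<varpi> ^ k dvd y - x"
  by (auto simp: padic_p_power_dvd_diff_iff)

lemma padic_p_neq_0 [simp]: "(\<varpi> :: 'p::prime_card padic_int) \<noteq> 0"
  by (simp add: padic_p_def)

lemma padic_p_power_dvd_of_nat_iff: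
  "(\<varpi> :: 'p::prime_card padic_int) ^ k dvd of_nat m \<longleftrightarrow> CARD('p) ^ k dvd m"
  by (metis dvd_eq_mod_eq_0 int_dvd_int_iff of_nat_power padic_p_power_dvd_iff padic_res_of_nat)

lemma prime_elem_padic_p: "prime_elem (\<varpi> :: 'p::prime_card padic_int)"
proof (rule prime_elemI)
  have dvd1: "\<varpi> dvd x \<longleftrightarrow> padic_res x 1 = 0" for x :: "'p padic_int"
    using padic_p_power_dvd_iff[of 1 x] by simp
  show "\<not> (\<varpi> :: 'p padic_int) dvd 1"
    using CARD_gt_1[where 'p='p] by (simp add: dvd1 padic_res_simps)
  fix a b :: "'p padic_int"
  assume "\<varpi> dvd a * b"
  then have "int CARD('p) dvd padic_res a 1 * padic_res b 1"
    by (auto simp: dvd1 padic_res_simps)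
  then have "int CARD('p) dvd padic_res a 1 \<or> int CARD('p) dvd padic_res b 1"
    using CARD_prime_int[where 'p='p] by (simp add: prime_dvd_mult_iff)
  then show "\<varpi> dvd a \<or> \<varpi> dvd b"
    using padic_res_mod_self[of a 1] padic_res_mod_self[of b 1] by (auto simp: dvd1)
qed simp

lemma ex_nat_padic_cong:
  fixes x :: "'p::prime_card padic_int"
  shows "\<exists>m. \<varpi> ^ k dvd x - of_nat m"
  using padic_res_bounds[of x k]
  by (intro exI[of _ "nat (padic_res x k)"])
    (simp add: padic_p_power_dvd_diff_iff padic_res_of_nat del: of_nat_nat)

lemma compatibleD:
  fixes f :: "'p::prime_card padic_int \<Rightarrow> 'p padic_int"
  assumes "compatible f" "\<varpi> ^ k dvd x - y"
  shows "\<varpi> ^ k dvd f x - f y"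
proof -
  have "pint_norm (f x - f y) \<le> pint_norm (x - y)"
    using assms(1) by (simp add: compatible_def)
  also have "\<dots> \<le> 1 / real CARD('p) ^ k"
    using assms(2) by (simp add: padic_norm_le_iff padic_p_power_dvd_iff)
  finally show ?thesis by (simp add: padic_norm_le_iff padic_p_power_dvd_iff)
qed

lemma compatible_funpowD:
  fixes f :: "'p::prime_card padic_int \<Rightarrow> 'p padic_int"
  assumes "compatible f" "\<varpi> ^ k dvd x - y"
  shows "\<varpi> ^ k dvd (f ^^ j) x - (f ^^ j) y"
  by (induction j) (use assms compatibleD in auto)

subsection \<open>Transitivity modulo prime powers\<close>

text \<open>A form of transitivity that avoids the induced map on residues: each forward orbit,
  starting with \<open>j = 0\<close>, meets each class modulo \<open>p ^ k\<close>. Passing to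
  smaller \<open>k\<close> is then immediate.\<close>

definition minimal_mod :: "('p::prime_card padic_int \<Rightarrow> 'p padic_int) \<Rightarrow> nat \<Rightarrow> bool" where
  "minimal_mod f k \<longleftrightarrow> (\<forall>x y. \<exists>j. \<varpi> ^ k dvd (f ^^ j) x - y)"

lemma minimal_mod_antimono:
  "minimal_mod f k \<Longrightarrow> l \<le> k \<Longrightarrow> minimal_mod f l"
  unfolding minimal_mod_def by (meson dvd_trans le_imp_power_dvd)

lemma transitive_mod_iff_minimal_mod:
  fixes f :: "'p::prime_card padic_int \<Rightarrow> 'p padic_int"
  assumes "compatible f"
  shows "transitive_mod f k \<longleftrightarrow> minimal_mod f k"
proof
  assume "transitive_mod f k"
  then obtain g where g: "\<And>x. padic_res (f x) k = g (padic_res x k)"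
    and cyc: "cyclic_on g {0..<int CARD('p) ^ k}"
    unfolding transitive_mod_def by blast
  obtain s where s: "s \<in> {0..<int CARD('p) ^ k}" "{0..<int CARD('p) ^ k} = orbit g s"
    using cyc unfolding cyclic_on_def by blast
  have pow: "padic_res ((f ^^ j) x) k = (g ^^ j) (padic_res x k)" for j x
    by (induction j) (auto simp: g)
  show "minimal_mod f k"
    unfolding minimal_mod_def
  proof (intro allI)
    fix x y :: "'p padic_int"
    have "padic_res x k \<in> orbit g s" "padic_res y k \<in> orbit g s"
      using padic_res_bounds[of x k] padic_res_bounds[of y k] by (auto simp flip: s(2))
    moreover have "s \<in> orbit g s" using s by blast
    ultimately have "padic_res y k \<in> orbit g (padic_res x k)"
      using orbit_swap orbit_trans by metis
    then show "\<exists>j. \<varpi> ^ k dvd (f ^^ j) x - y"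
      by (auto simp: orbit_altdef padic_p_power_dvd_diff_iff pow)
  qed
next
  assume min: "minimal_mod f k"
  define S where "S = {0..<int CARD('p) ^ k}"
  define g where "g r = padic_res (f (of_nat (nat r))) k" for r
  have res_nat: "padic_res (of_nat (nat (padic_res x k)) :: 'p padic_int) k = padic_res x k" for x :: "'p padic_int"
    using padic_res_bounds[of x k] by (simp add: padic_res_of_nat del: of_nat_nat)
  have g: "padic_res (f x) k = g (padic_res x k)" for x
    using compatibleD[OF assms, of k x "of_nat (nat (padic_res x k))"] res_nat[of x]
    by (simp add: padic_p_power_dvd_diff_iff g_def)
  have pow: "padic_res ((f ^^ j) x) k = (g ^^ j) (padic_res x k)" for j x
    by (induction j) (auto simp: g)
  have S: "padic_res x k \<in> S" for x :: "'p padic_int"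
    using padic_res_bounds[of x k] by (simp add: S_def)
  have S_res: "\<exists>x :: 'p padic_int. r = padic_res x k" if "r \<in> S" for r
    using that by (intro exI[of _ "of_nat (nat r)"]) (simp add: padic_res_of_nat S_def del: of_nat_nat)
  have sub: "orbit g (padic_res x k) \<subseteq> S" for x :: "'p padic_int"
    using S by (auto simp: orbit_altdef simp flip: pow)
  have sup: "S \<subseteq> orbit g (padic_res x k)" for x :: "'p padic_int"
  proof
    fix r assume "r \<in> S"
    then obtain y :: "'p padic_int" where y: "r = padic_res y k" using S_res by blast
    \<comment> \<open>Minimality is applied to \<open>f x\<close> instead of \<open>x\<close>, since
      \<open>orbit\<close> contains only iterates with positive exponent.\<close>
    obtain j where "\<varpi> ^ k dvd (f ^^ j) (f x) - y"
      using min unfolding minimal_mod_def by blast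
    then have "r = (g ^^ Suc j) (padic_res x k)"
      by (simp add: y padic_p_power_dvd_diff_iff pow g funpow_swap1)
    then show "r \<in> orbit g (padic_res x k)"
      unfolding orbit_altdef by blast
  qed
  have orb: "orbit g (padic_res x k) = S" for x :: "'p padic_int"
    using sub sup by blast
  have "g ` S = S"
  proof (intro equalityI subsetI)
    fix r assume "r \<in> S"
    \<comment> \<open>Each residue returns to itself, so it is a value of \<open>g\<close>; a
      surjection of a finite set onto itself is bijective.\<close>
    then have "r \<in> orbit g r" using orb S_res by metis
    then obtain n where "r = (g ^^ Suc n) r"
      unfolding orbit_altdef by (auto simp: gr0_conv_Suc)
    moreover have "(g ^^ n) r \<in> S"
      using S_res[OF \<open>r \<in> S\<close>] S by (auto simp flip: pow)
    ultimately show "r \<in> g ` S" by auto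
  next
    fix r assume "r \<in> g ` S"
    then obtain x :: "'p padic_int" where "r = g (padic_res x k)" using S_res by blast
    then show "r \<in> S" using S[of "f x"] by (simp add: g)
  qed
  then have "bij_betw g S S"
    by (simp add: bij_betw_def S_def eq_card_imp_inj_on)
  moreover have "cyclic_on g S"
    using orb[of 0] S[of 0] unfolding cyclic_on_def by blast
  ultimately show "transitive_mod f k"
    using g unfolding transitive_mod_def S_def by blast
qed

text \<open>The hypothesis makes \<open>s\<close> periodic. Its least return time \<open>d\<close>
  is the size of the orbit, because the iterates before \<open>d\<close> are distinct and the later
  ones repeat them.\<close>

lemma funpow_eq_iff_mod_card:
  assumes "s \<in> orbit g s"
  shows "(g ^^ i) s = (g ^^ j) s \<longleftrightarrow> i mod card (orbit g s) = j mod card (orbit g s)"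
proof -
  define d where "d = (LEAST d. 0 < d \<and> (g ^^ d) s = s)"
  have "\<exists>d. 0 < d \<and> (g ^^ d) s = s" using assms by (force simp: orbit_altdef)
  then have d: "0 < d" "(g ^^ d) s = s" unfolding d_def by (metis (mono_tags, lifting) LeastI_ex)+
  have least: "\<not> (0 < e \<and> (g ^^ e) s = s)" if "e < d" for e
    using that not_less_Least unfolding d_def by blast
  have inj: "inj_on (\<lambda>j. (g ^^ j) s) {..<d}"
  proof (rule linorder_inj_onI)
    fix i j assume ij: "i < j" "i \<in> {..<d}" "j \<in> {..<d}"
    show "(g ^^ i) s \<noteq> (g ^^ j) s"
    proof
      assume "(g ^^ i) s = (g ^^ j) s"
      \<comment> \<open>Applying \<open>d - j\<close> further iterates would produce the return time
        \<open>d - j + i\<close>, which is smaller than \<open>d\<close>.\<close>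
      then have "(g ^^ (d - j)) ((g ^^ i) s) = (g ^^ (d - j)) ((g ^^ j) s)" by simp
      then have "(g ^^ (d - j + i)) s = s"
        using ij d(2) by (simp flip: funpow_add comp_apply[of "g ^^ _" "g ^^ _"])
      then show False using least[of "d - j + i"] ij by auto
    qed
  qed auto
  have "orbit g s = (\<lambda>j. (g ^^ j) s) ` {..<d}"
    using orbit_altdef_bounded[OF d(2,1)] by auto
  then have card: "card (orbit g s) = d" using inj by (simp add: card_image)
  have "(g ^^ i) s = (g ^^ (i mod d)) s" for i by (rule funpow_mod_eq[OF d(2), symmetric])
  then show ?thesis
    unfolding card using inj d(1) by (metis inj_onD lessThan_iff mod_less_divisor)
qed

text \<open>This reduces transitivity to the return times of the single point 0. A cycle of length
  \<open>p ^ k\<close> returns exactly at the multiples of its length; conversely, such return times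
  make the first \<open>p ^ k\<close> residues on the orbit of 0 distinct, so that they exhaust all
  residues.\<close>

lemma minimal_mod_iff:
  fixes f :: "'p::prime_card padic_int \<Rightarrow> 'p padic_int"
  assumes "compatible f"
  shows "minimal_mod f k \<longleftrightarrow> (\<forall>j. \<varpi> ^ k dvd (f ^^ j) 0 \<longleftrightarrow> CARD('p) ^ k dvd j)"
proof
  assume "minimal_mod f k"
  then have "transitive_mod f k" using transitive_mod_iff_minimal_mod[OF assms] by simp
  then obtain g where g: "\<And>x. padic_res (f x) k = g (padic_res x k)"
    and cyc: "cyclic_on g {0..<int CARD('p) ^ k}"
    unfolding transitive_mod_def by blast
  obtain s where s: "s \<in> {0..<int CARD('p) ^ k}" "{0..<int CARD('p) ^ k} = orbit g s"
    using cyc unfolding cyclic_on_def by blast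
  have 0: "0 \<in> orbit g s" by (simp flip: s(2))
  have orb: "orbit g 0 = {0..<int CARD('p) ^ k}"
    using s 0 orbit_swap orbit_trans by (metis subsetI subset_antisym)
  then have 00: "0 \<in> orbit g 0" by simp
  have card: "card (orbit g 0) = CARD('p) ^ k"
    by (simp add: orb nat_power_eq)
  have pow: "padic_res ((f ^^ j) x) k = (g ^^ j) (padic_res x k)" for j x
    by (induction j) (auto simp: g)
  show "\<forall>j. \<varpi> ^ k dvd (f ^^ j) 0 \<longleftrightarrow> CARD('p) ^ k dvd j"
    using funpow_eq_iff_mod_card[OF 00, of _ 0]
    by (auto simp: padic_p_power_dvd_iff pow padic_res_simps card dvd_eq_mod_eq_0)
next
  assume T: "\<forall>j. \<varpi> ^ k dvd (f ^^ j) 0 \<longleftrightarrow> CARD('p) ^ k dvd j"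
  define q where "q = CARD('p) ^ k"
  have q: "q > 0" by (simp add: q_def)
  define u where "u j = padic_res ((f ^^ j) 0) k" for j
  have shift: "u (i + m) = u (j + m)" if "u i = u j" for i j m
    using compatible_funpowD[OF assms, of k "(f ^^ i) 0" "(f ^^ j) 0" m] that
    by (simp add: u_def padic_p_power_dvd_diff_iff add.commute[of _ m] funpow_add)
  have u0: "u j = 0 \<longleftrightarrow> q dvd j" for j
    using T by (simp add: u_def q_def padic_p_power_dvd_iff)
  have inj: "inj_on u {..<q}"
  proof (rule linorder_inj_onI)
    fix i j assume ij: "i < j" "i \<in> {..<q}" "j \<in> {..<q}"
    show "u i \<noteq> u j"
    proof
      assume "u i = u j"
      then have "u (i + (q - i)) = u (j + (q - i))" by (rule shift)
      then have "u q = u (q + (j - i))" using ij by (simp add: add.commute)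
      moreover have "u q = 0" by (simp add: u0)
      ultimately have "q dvd q + (j - i)" using u0[of "q + (j - i)"] by metis
      then have "q dvd j - i" by simp
      then show False using ij by (auto dest: dvd_imp_le)
    qed
  qed auto
  have "u ` {..<q} = {0..<int q}"
  proof (rule card_subset_eq)
    show "u ` {..<q} \<subseteq> {0..<int q}"
      using padic_res_bounds by (auto simp: u_def q_def)
  qed (simp_all add: card_image inj)
  moreover have "padic_res x k \<in> {0..<int q}" for x :: "'p padic_int"
    using padic_res_bounds[of x k] by (simp add: q_def)
  ultimately have surj: "\<exists>j. u j = padic_res x k" for x :: "'p padic_int"
    by (metis imageE)
  show "minimal_mod f k"
    unfolding minimal_mod_def
  proof (intro allI)
    fix x y :: "'p padic_int"
    obtain i j where i: "u i = padic_res x k" and j: "u j = padic_res y k" using surj by metis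
    \<comment> \<open>Only forward iterates are available, so the multiple \<open>q * i\<close> of
      the period is added to \<open>j\<close> in order to exceed \<open>i\<close>.\<close>
    have "u (q * i) = u 0" using u0[of "q * i"] u0[of 0] by simp
    from shift[OF this, of j] have "u (q * i + j) = u j" by simp
    moreover have "i \<le> q * i + j" using q by (simp add: trans_le_add1)
    ultimately obtain m where m: "u (m + i) = padic_res y k"
      using j by (metis le_add_diff_inverse2)
    have "\<varpi> ^ k dvd (f ^^ m) x - (f ^^ m) ((f ^^ i) 0)"
      by (rule compatible_funpowD[OF assms]) (use i in \<open>simp add: u_def padic_p_power_dvd_diff_iff\<close>)
    then have "padic_res ((f ^^ m) x) k = u (m + i)"
      by (simp add: u_def padic_p_power_dvd_diff_iff funpow_add)
    then show "\<exists>j. \<varpi> ^ k dvd (f ^^ j) x - y"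
      using m by (auto simp: padic_p_power_dvd_diff_iff)
  qed
qed

subsection \<open>Ergodicity\<close>

lemma sets_padic_haar: "sets (padic_haar :: 'p::prime_card padic_int measure) = sets borel"
  using normalized_haar_padic_haar[where 'a='p] by (simp add: normalized_haar_def)

lemma emeasure_padic_haar_UNIV: "emeasure (padic_haar :: 'p::prime_card padic_int measure) UNIV = 1"
  using normalized_haar_padic_haar[where 'a='p] by (simp add: normalized_haar_def)

lemma space_padic_haar: "space (padic_haar :: 'p::prime_card padic_int measure) = UNIV"
  using sets_eq_imp_space_eq[OF sets_padic_haar] by simp

lemma padic_cyl_in_sets: "padic_cyl n r \<in> sets (borel :: 'p::prime_card padic_int measure)"
  by (rule borel_open[OF open_padic_cyl])

lemma borel_measurable_compatible:
  fixes f :: "'p::prime_card padic_int \<Rightarrow> 'p padic_int"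
  assumes "compatible f"
  shows "f \<in> measurable borel borel"
proof (rule borel_measurable_continuous_onI)
  have "dist (f x) (f y) \<le> dist x y" for x y
    using assms by (simp add: compatible_def dist_padic_int_def)
  then show "continuous_on UNIV f"
    unfolding continuous_on_iff by (meson order_le_less_trans)
qed

lemma padic_periodic_in_sets:
  fixes A :: "'p::prime_card padic_int set"
  assumes "\<And>x y. x \<in> A \<Longrightarrow> \<varpi> ^ k dvd x - y \<Longrightarrow> y \<in> A"
  shows "A \<in> sets padic_haar"
proof -
  have "A = (\<Union>r\<in>(\<lambda>x. padic_res x k) ` A. padic_cyl k r)"
    using assms by (auto simp: padic_cyl_def padic_p_power_dvd_diff_iff)
  moreover have "open \<dots>" by (intro open_UN ballI open_padic_cyl)
  ultimately show ?thesis by (metis borel_open sets_padic_haar)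
qed

text \<open>A nonempty union of classes modulo \<open>p ^ k\<close> contains a whole cylinder, whose
  measure \<open>1 / p ^ k\<close> is positive.\<close>

lemma padic_periodic_null:
  fixes A :: "'p::prime_card padic_int set"
  assumes "\<And>x y. x \<in> A \<Longrightarrow> \<varpi> ^ k dvd x - y \<Longrightarrow> y \<in> A"
    and "emeasure padic_haar A = 0"
  shows "A = {}"
proof (rule ccontr)
  assume "A \<noteq> {}"
  then obtain x where x: "x \<in> A" by blast
  have "padic_cyl k (padic_res x k) \<subseteq> A"
    using x assms(1) by (auto simp: padic_cyl_def padic_p_power_dvd_diff_iff)
  then have "emeasure padic_haar (padic_cyl k (padic_res x k) :: 'p padic_int set) \<le> emeasure padic_haar A"
    by (intro emeasure_mono padic_periodic_in_sets[OF assms(1)])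
  moreover have "emeasure padic_haar (padic_cyl k (padic_res x k) :: 'p padic_int set) = 1 / of_nat (CARD('p) ^ k)"
    using padic_res_bounds[of x k] by (intro normalized_haar_cyl normalized_haar_padic_haar) auto
  ultimately show False
    using assms(2) by (simp add: ennreal_divide_eq_0_iff del: of_nat_power)
qed

lemma ergodic_imp_minimal_mod:
  fixes f :: "'p::prime_card padic_int \<Rightarrow> 'p padic_int"
  assumes f: "compatible f" and erg: "ergodic f"
  shows "minimal_mod f k"
  unfolding minimal_mod_def
proof
  fix x :: "'p padic_int"
  define U where "U = {y. \<exists>j. \<varpi> ^ k dvd (f ^^ j) x - y}"
  have per: "z \<in> U" if y: "y \<in> U" "\<varpi> ^ k dvd y - z" for y z
  proof -
    obtain j where "\<varpi> ^ k dvd (f ^^ j) x - y" using y by (auto simp: U_def)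
    from dvd_add[OF this y(2)] have "\<varpi> ^ k dvd (f ^^ j) x - z" by simp
    then show ?thesis unfolding U_def by blast
  qed
  have fwd: "f y \<in> U" if y: "y \<in> U" for y
  proof -
    obtain j where "\<varpi> ^ k dvd (f ^^ j) x - y" using y by (auto simp: U_def)
    then have "\<varpi> ^ k dvd (f ^^ Suc j) x - f y" using compatibleD[OF f] by simp
    then show ?thesis unfolding U_def by blast
  qed
  have per': "z \<in> f -` U" if "y \<in> f -` U" "\<varpi> ^ k dvd y - z" for y z
    using that per[of "f y" "f z"] compatibleD[OF f] by auto
  have perD: "z \<in> f -` U - U" if "y \<in> f -` U - U" "\<varpi> ^ k dvd y - z" for y z
    using that per'[of y z] per[of z y] padic_p_power_dvd_diff_commute[of k y z] by auto
  have sets: "U \<in> sets padic_haar" "f -` U \<in> sets padic_haar"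
    using padic_periodic_in_sets per per' by blast+
  have fin: "emeasure padic_haar V \<noteq> \<infinity>" for V :: "'p padic_int set"
  proof -
    have "emeasure padic_haar V \<le> 1"
      using emeasure_space[of padic_haar V] by (simp add: space_padic_haar emeasure_padic_haar_UNIV)
    then show ?thesis by (auto simp: top_unique)
  qed
  have "emeasure padic_haar (f -` U - U) = emeasure padic_haar (f -` U) - emeasure padic_haar U"
    using sets fwd fin by (intro emeasure_Diff) auto
  also have "\<dots> = 0"
    using erg sets fin[of U] by (simp add: ergodic_def)
  finally have "f -` U - U = {}" using padic_periodic_null[of "f -` U - U" k] perD by blast
  then have "f -` U = U" using fwd by blast
  then have "emeasure padic_haar U \<in> {0, 1}" using erg sets by (simp add: ergodic_def)
  moreover have "x \<in> U" unfolding U_def by (auto intro: exI[of _ 0])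
  then have "emeasure padic_haar U \<noteq> 0" using padic_periodic_null[of U k] per by blast
  ultimately have 1: "emeasure padic_haar U = 1" by simp
  have perC: "z \<in> - U" if "y \<in> - U" "\<varpi> ^ k dvd y - z" for y z
    using that per[of z y] padic_p_power_dvd_diff_commute[of k y z] by auto
  have "emeasure padic_haar (UNIV - U) = emeasure padic_haar (UNIV :: 'p padic_int set) - emeasure padic_haar U"
    using sets fin by (intro emeasure_Diff) (auto simp: sets_padic_haar)
  then have "emeasure padic_haar (- U) = 0"
    by (simp add: 1 emeasure_padic_haar_UNIV Compl_eq_Diff_UNIV)
  then have "- U = {}" using padic_periodic_null[of "- U" k] perC by blast
  then show "\<forall>y. \<exists>j. \<varpi> ^ k dvd (f ^^ j) x - y" unfolding U_def by blast
qed

text \<open>Invariance carries the mass of a cylinder along the cycle of \<open>g\<close>, so all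
  \<open>p ^ n\<close> cylinders have equal mass. The measure \<open>N\<close> is left general
  because the lemma is applied to Haar measure restricted to an invariant set.\<close>

lemma measure_cyl_eq_of_transitive_mod:
  fixes f :: "'p::prime_card padic_int \<Rightarrow> 'p padic_int" and N :: "'p padic_int measure"
  assumes "transitive_mod f n" and sets_N: "sets N = sets borel"
    and inv: "\<And>r. emeasure N (f -` padic_cyl n r) = emeasure N (padic_cyl n r)"
    and r: "r \<in> {0..<int CARD('p) ^ n}"
  shows "emeasure N (padic_cyl n r) = emeasure N UNIV * emeasure padic_haar (padic_cyl n r :: 'p padic_int set)"
proof -
  define S where "S = {0..<int CARD('p) ^ n}"
  obtain g where g: "\<And>x. padic_res (f x) n = g (padic_res x n)"
    and bij: "bij_betw g S S" and cyc: "cyclic_on g S"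
    using assms(1) unfolding transitive_mod_def S_def by blast
  obtain s where s: "s \<in> S" "S = orbit g s"
    using cyc unfolding cyclic_on_def by blast
  have res: "padic_res x n \<in> S" for x :: "'p padic_int"
    using padic_res_bounds[of x n] by (simp add: S_def)
  have pre: "f -` padic_cyl n (g r) = padic_cyl n r" if "r \<in> S" for r
    using bij_betw_imp_inj_on[OF bij] that res by (auto simp: padic_cyl_def g dest: inj_onD)
  have step: "emeasure N (padic_cyl n (g r)) = emeasure N (padic_cyl n r)" if "r \<in> S" for r
    using inv[of "g r"] pre[OF that] by simp
  have eq: "emeasure N (padic_cyl n r) = emeasure N (padic_cyl n s)" if "r \<in> S" for r
  proof -
    have "r \<in> orbit g s" using that s by simp
    then show ?thesis
      by induction (use step s in auto)
  qed
  define q where "q = CARD('p) ^ n"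
  have q: "q > 0" by (simp add: q_def)
  have U: "(UNIV :: 'p padic_int set) = (\<Union>s\<in>S. padic_cyl n s)"
    using res by (auto simp: padic_cyl_def)
  have "emeasure N UNIV = emeasure N (\<Union>s\<in>S. padic_cyl n s)"
    using U by simp
  also have "\<dots> = (\<Sum>s\<in>S. emeasure N (padic_cyl n s))"
    by (rule sum_emeasure[symmetric])
      (use padic_cyl_in_sets in \<open>auto simp: disjoint_family_on_def padic_cyl_def S_def sets_N\<close>)
  also have "\<dots> = (\<Sum>s'\<in>S. emeasure N (padic_cyl n r))"
    by (intro sum.cong refl) (use eq r S_def in force)
  also have "\<dots> = of_nat q * emeasure N (padic_cyl n r)"
    by (simp add: S_def q_def nat_power_eq)
  finally have *: "emeasure N UNIV = of_nat q * emeasure N (padic_cyl n r)" .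
  have "emeasure N (padic_cyl n r) = emeasure N (padic_cyl n r) * of_nat q / of_nat q"
    using q by (intro ennreal_mult_divide_eq[symmetric]) auto
  also have "\<dots> = emeasure N UNIV * (1 / of_nat q)"
    unfolding * by (simp add: ennreal_times_divide mult.commute[of "emeasure N _"])
  finally show ?thesis
    using normalized_haar_cyl[OF normalized_haar_padic_haar r] by (simp add: q_def)
qed

lemma transitive_mod_imp_ergodic:
  fixes f :: "'p::prime_card padic_int \<Rightarrow> 'p padic_int"
  assumes f: "compatible f" and trans: "\<And>k. transitive_mod f k"
  shows "ergodic f"
proof -
  define M :: "'p padic_int measure" where "M = padic_haar"
  have sets_M [measurable_cong]: "sets M = sets borel" by (simp add: M_def sets_padic_haar)
  have space_M: "space M = UNIV" by (simp add: M_def space_padic_haar)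
  have M1: "emeasure M UNIV = 1" by (simp add: M_def emeasure_padic_haar_UNIV)
  have meas_borel: "f \<in> measurable borel borel" by (rule borel_measurable_compatible[OF f])
  have meas: "f \<in> measurable M M"
    using meas_borel by (simp add: measurable_cong_sets[OF sets_M sets_M])
  have cyl_pre: "emeasure M (f -` padic_cyl n r) = emeasure M (padic_cyl n r)" for n r
  proof (cases "r \<in> {0..<int CARD('p) ^ n}")
    case True
    obtain g where g: "\<And>x. padic_res (f x) n = g (padic_res x n)"
      and bij: "bij_betw g {0..<int CARD('p) ^ n} {0..<int CARD('p) ^ n}"
      using trans[of n] unfolding transitive_mod_def by blast
    obtain s where s: "s \<in> {0..<int CARD('p) ^ n}" "r = g s"
      using bij True unfolding bij_betw_def by blast
    have res: "padic_res x n \<in> {0..<int CARD('p) ^ n}" for x :: "'p padic_int"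
      using padic_res_bounds[of x n] by simp
    have "f -` padic_cyl n r = padic_cyl n s"
      using bij_betw_imp_inj_on[OF bij] s res by (auto simp: padic_cyl_def g dest: inj_onD)
    then show ?thesis
      using normalized_haar_cyl[OF normalized_haar_padic_haar, of _ n, where 'p='p] s(1) True by (simp add: M_def)
  next
    case False
    then show ?thesis by (simp add: padic_cyl_eq_empty)
  qed
  have "M = distr M M f"
  proof (rule padic_measure_eqI)
    show "emeasure M (padic_cyl n r) = emeasure (distr M M f) (padic_cyl n r)" for n r
      using cyl_pre[of n r] by (subst emeasure_distr[OF meas]) (auto simp: sets_M padic_cyl_in_sets space_M)
  qed (auto simp: sets_M M1)
  then have pres: "emeasure M (f -` U) = emeasure M U" if "U \<in> sets M" for U
    using emeasure_distr[OF meas that] by (simp add: space_M)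
  have "emeasure M U \<in> {0, 1}" if U: "U \<in> sets M" "f -` U = U" for U
  proof -
    \<comment> \<open>Since \<open>U\<close> is invariant, the restriction \<open>N\<close> of
      \<open>M\<close> to \<open>U\<close> is invariant under \<open>f\<close>, hence equals
      \<open>M\<close> scaled by the measure of \<open>U\<close>. Evaluating both measures at
      \<open>U\<close> shows that this number is its own square.\<close>
    define N where "N = density M (indicator U)"
    have sets_N: "sets N = sets borel" by (simp add: N_def sets_M)
    have N: "emeasure N A = emeasure M (U \<inter> A)" if "A \<in> sets M" for A
      using that U(1) unfolding N_def by (subst emeasure_density) (auto simp: indicator_inter_arith[symmetric] sets.Int)
    have pre_sets: "f -` A \<in> sets M" if "A \<in> sets M" for A
      using measurable_sets[OF meas that] by (simp add: space_M)
    have N_inv: "emeasure N (f -` A) = emeasure N A" if "A \<in> sets M" for A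
    proof -
      have "emeasure N (f -` A) = emeasure M (f -` (U \<inter> A))"
        using that U(2) by (simp add: N pre_sets)
      also have "\<dots> = emeasure N A" using that U(1) by (subst pres) (auto simp: N)
      finally show ?thesis .
    qed
    have NU: "emeasure N UNIV = emeasure M U"
      using N[of UNIV] by (simp add: sets_M)
    have "N = scale_measure (emeasure M U) M"
    proof (rule padic_measure_eqI)
      have "emeasure M U \<le> 1" using emeasure_space[of M U] by (simp add: space_M M1)
      then show "emeasure N UNIV \<noteq> \<infinity>" by (auto simp: NU top_unique)
      show "emeasure N (padic_cyl n r) = emeasure (scale_measure (emeasure M U) M) (padic_cyl n r)"
        if "r \<in> {0..<int CARD('p) ^ n}" for n r
        using measure_cyl_eq_of_transitive_mod[OF trans sets_N _ that] N_inv
        by (simp add: sets_M padic_cyl_in_sets NU flip: M_def)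
    qed (auto simp: sets_N sets_M)
    then have "emeasure N U = emeasure M U * emeasure M U" by simp
    then have eq: "emeasure M U = emeasure M U * emeasure M U" using N[OF U(1)] by simp
    have "emeasure M U \<noteq> \<infinity>"
      using emeasure_space[of M U] by (auto simp: space_M M1 top_unique)
    then obtain c where c: "emeasure M U = ennreal c" "c \<ge> 0" by (cases "emeasure M U") auto
    then have "c = c * c" using eq by (simp flip: ennreal_mult)
    then show ?thesis using c by auto
  qed
  then show ?thesis
    unfolding ergodic_def using meas pres by (simp add: M_def)
qed

lemma ergodic_iff_minimal_mod:
  fixes f :: "'p::prime_card padic_int \<Rightarrow> 'p padic_int"
  assumes "compatible f"
  shows "ergodic f \<longleftrightarrow> (\<forall>k. minimal_mod f k)"
  using ergodic_imp_minimal_mod[OF assms] transitive_mod_imp_ergodic[OF assms]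
    transitive_mod_iff_minimal_mod[OF assms] by blast

subsection \<open>Finite differences\<close>

text \<open>Differences are taken along the natural numbers, which are dense and on which the
  interpolation series is a finite sum.\<close>

definition step_diff :: "nat \<Rightarrow> (nat \<Rightarrow> 'a::comm_ring_1) \<Rightarrow> nat \<Rightarrow> 'a" where
  "step_diff h F x = F (x + h) - F x"

definition fwd_diff :: "(nat \<Rightarrow> 'a::comm_ring_1) \<Rightarrow> nat \<Rightarrow> 'a" where
  "fwd_diff F x = F (Suc x) - F x"

text \<open>The induction hypothesis is used for both \<open>F\<close> and
  \<open>fwd_diff F\<close>; Pascal's rule merges the two sums.\<close>

lemma newton_forward:
  "F (x + h) = (\<Sum>j\<le>h. of_nat (h choose j) * (fwd_diff ^^ j) F x)"
proof (induction h arbitrary: F)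
  case (Suc h)
  have "F (x + Suc h) = F (x + h) + fwd_diff F (x + h)"
    by (simp add: fwd_diff_def)
  also have "\<dots> = (\<Sum>j\<le>h. of_nat (h choose j) * (fwd_diff ^^ j) F x)
      + (\<Sum>j\<le>h. of_nat (h choose j) * (fwd_diff ^^ Suc j) F x)"
    by (simp add: Suc.IH[of F] Suc.IH[of "fwd_diff F"] funpow_swap1)
  also have "(\<Sum>j\<le>h. of_nat (h choose j) * (fwd_diff ^^ j) F x)
      = (\<Sum>j\<le>Suc h. of_nat (h choose j) * (fwd_diff ^^ j) F x)"
    by (simp add: binomial_eq_0)
  also have "\<dots> = F x + (\<Sum>j\<le>h. of_nat (h choose Suc j) * (fwd_diff ^^ Suc j) F x)"
    by (subst sum.atMost_Suc_shift) simp
  finally show ?case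
    by (subst sum.atMost_Suc_shift) (simp add: sum.distrib algebra_simps)
qed simp

lemma step_diff_eq_sum:
  "step_diff h F x = (\<Sum>j=1..h. of_nat (h choose j) * (fwd_diff ^^ j) F x)"
proof -
  have "{..h} = insert 0 {1..h}" by auto
  then show ?thesis
    by (simp add: step_diff_def newton_forward)
qed

lemma fwd_diff_step_diff_commute: "fwd_diff (step_diff h F) = step_diff h (fwd_diff F)"
  by (rule ext) (simp add: step_diff_def fwd_diff_def)

lemma fwd_diff_funpow_step_diff:
  "(fwd_diff ^^ j) (step_diff h F) = step_diff h ((fwd_diff ^^ j) F)"
  by (induction j) (simp_all add: fwd_diff_step_diff_commute)

lemma step_diff_dvdI:
  assumes "\<And>j. j \<in> {1..h} \<Longrightarrow> d dvd of_nat (h choose j) * (fwd_diff ^^ j) F x"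
  shows "d dvd step_diff h F x"
  unfolding step_diff_eq_sum by (intro dvd_sum assms)

lemma fwd_diff_funpow_step_diff_eq_sum:
  "(fwd_diff ^^ i) (step_diff h F) x = (\<Sum>j=1..h. of_nat (h choose j) * (fwd_diff ^^ (i + j)) F x)"
  unfolding fwd_diff_funpow_step_diff step_diff_eq_sum by (simp add: funpow_add add.commute[of i])

text \<open>Newton's formula, applied to each of the two step differences, gives a double sum that
  can be tested term by term.\<close>

lemma step_diff_funpow2_dvdI:
  fixes F :: "nat \<Rightarrow> 'a::comm_ring_1"
  assumes "\<And>i j. i \<in> {1..h} \<Longrightarrow> j \<in> {1..h} \<Longrightarrow>
    d dvd of_nat (h choose i) * (of_nat (h choose j) * (fwd_diff ^^ (i + j)) F x)"
  shows "d dvd (step_diff h ^^ 2) F x"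
proof -
  have "d dvd step_diff h (step_diff h F) x"
    by (rule step_diff_dvdI)
      (unfold fwd_diff_funpow_step_diff_eq_sum sum_distrib_left, intro dvd_sum assms)
  then show ?thesis by (simp add: numeral_2_eq_2)
qed

lemma step_diff_funpow3_dvdI:
  fixes F :: "nat \<Rightarrow> 'a::comm_ring_1"
  assumes "\<And>i j l. i \<in> {1..h} \<Longrightarrow> j \<in> {1..h} \<Longrightarrow> l \<in> {1..h} \<Longrightarrow>
    d dvd of_nat (h choose i) * (of_nat (h choose j) * (of_nat (h choose l) * (fwd_diff ^^ (i + j + l)) F x))"
  shows "d dvd (step_diff h ^^ 3) F x"
proof -
  have "d dvd (step_diff h ^^ 2) (step_diff h F) x"
    by (rule step_diff_funpow2_dvdI)
      (unfold fwd_diff_funpow_step_diff_eq_sum sum_distrib_left, intro dvd_sum assms)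
  then show ?thesis by (simp add: numeral_3_eq_3 numeral_2_eq_2)
qed

lemma fwd_diff_funpow_dvd:
  assumes "\<And>x. d dvd F x"
  shows "d dvd (fwd_diff ^^ j) F x"
  by (induction j arbitrary: x) (use assms in \<open>auto simp: fwd_diff_def\<close>)

text \<open>By Pascal's rule a difference lowers the index of each binomial coefficient, which
  amounts to shifting the coefficients \<open>a\<close> by one.\<close>

lemma fwd_diff_binomial_sum:
  fixes a :: "nat \<Rightarrow> 'a::comm_ring_1"
  shows "(fwd_diff ^^ j) (\<lambda>m. \<Sum>i\<le>m. a i * of_nat (m choose i))
    = (\<lambda>m. \<Sum>i\<le>m. a (i + j) * of_nat (m choose i))"
proof (induction j)
  case (Suc j)
  have *: "fwd_diff (\<lambda>m. \<Sum>i\<le>m. b i * of_nat (m choose i)) m = (\<Sum>i\<le>m. b (Suc i) * of_nat (m choose i))"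
    for b :: "nat \<Rightarrow> 'a" and m
  proof -
    \<comment> \<open>A vanishing term is appended so that the sums at \<open>m\<close> and
      \<open>Suc m\<close> have the same range.\<close>
    have "(\<Sum>i\<le>m. b i * of_nat (m choose i)) = (\<Sum>i\<le>Suc m. b i * of_nat (m choose i))"
      by (simp add: binomial_eq_0)
    then show ?thesis
      by (simp add: fwd_diff_def sum.atMost_Suc_shift distrib_left sum.distrib del: sum.atMost_Suc)
  qed
  show ?case by (rule ext) (simp add: Suc.IH *)
qed simp

text \<open>Absorption shows that \<open>p ^ n\<close> divides \<open>j * (p ^ n choose j)\<close>;
  the part of \<open>j\<close> prime to \<open>p\<close> can be cancelled. Here \<open>v\<close> is
  the multiplicity of \<open>p\<close> in \<open>j\<close>.\<close>

lemma prime_power_dvd_binomial: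
  fixes p :: nat
  assumes "prime p" "0 < j"
  obtains v where "p ^ v \<le> j" "p ^ v dvd j" "p ^ n dvd p ^ v * (p ^ n choose j)"
proof -
  obtain m where m: "j = p ^ multiplicity p j * m" "\<not> p dvd m"
    using multiplicity_decompose'[of j p] assms by (metis not_prime_unit not_gr_zero)
  have "p ^ n dvd j * (p ^ n choose j)"
    using assms(2) binomial_absorption[of "j - 1" "p ^ n"] by simp
  then have "p ^ n dvd m * (p ^ multiplicity p j * (p ^ n choose j))"
    by (subst (asm) m(1)) (simp add: ac_simps)
  moreover have "coprime (p ^ n) m"
    using m(2) assms(1) by (simp add: prime_imp_coprime coprime_power_left_iff)
  ultimately have "p ^ n dvd p ^ multiplicity p j * (p ^ n choose j)"
    by (simp add: coprime_dvd_mult_right_iff)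
  moreover have "p ^ multiplicity p j dvd j" by (rule multiplicity_dvd)
  ultimately show ?thesis using that dvd_imp_le[OF _ assms(2)] by blast
qed

lemma prime_power_diff_dvd_binomial:
  fixes p :: nat
  assumes "prime p" "0 < j" "\<not> p ^ Suc s dvd j" "s \<le> n"
  shows "p ^ (n - s) dvd (p ^ n choose j)"
proof -
  obtain v where v: "p ^ v dvd j" "p ^ n dvd p ^ v * (p ^ n choose j)"
    using prime_power_dvd_binomial[OF assms(1,2), of n] by metis
  have "v \<le> s"
    using v(1) assms(3) by (meson dvd_trans le_imp_power_dvd not_less_eq_eq)
  have "p ^ s * p ^ (n - s) = p ^ n" using assms(4) by (simp flip: power_add)
  moreover have "p ^ n dvd p ^ s * (p ^ n choose j)"
    using v(2) \<open>v \<le> s\<close> by (meson dvd_refl dvd_trans le_imp_power_dvd mult_dvd_mono)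
  ultimately have "p ^ s * p ^ (n - s) dvd p ^ s * (p ^ n choose j)" by simp
  then show ?thesis
    using prime_gt_0_nat[OF assms(1)] by simp
qed

lemma prime_dvd_binomial_prime_power:
  fixes p :: nat
  assumes "prime p" "0 < j" "j < p ^ n"
  shows "p dvd (p ^ n choose j)"
proof -
  obtain m where n: "n = Suc m" using assms(2,3) by (cases n) auto
  have "\<not> p ^ Suc m dvd j" using assms n by (auto dest: dvd_imp_le)
  from prime_power_diff_dvd_binomial[OF assms(1,2) this, of n] show ?thesis by (simp add: n)
qed

text \<open>The binomial coefficient falls short of \<open>p ^ n\<close> by at most a factor
  \<open>p ^ v\<close> with \<open>p ^ v \<le> j\<close>, and \<open>y\<close> supplies exactly this
  factor.\<close>

lemma padic_p_power_dvd_binomial_mult: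
  fixes y :: "'p::prime_card padic_int"
  assumes "0 < j" and y: "\<And>s. CARD('p) ^ s \<le> j \<Longrightarrow> \<varpi> ^ s dvd y"
  shows "\<varpi> ^ n dvd of_nat (CARD('p) ^ n choose j) * y"
proof -
  obtain v where v: "CARD('p) ^ v \<le> j" "CARD('p) ^ n dvd CARD('p) ^ v * (CARD('p) ^ n choose j)"
    using prime_power_dvd_binomial[OF CARD_prime[where 'p='p] assms(1), of n] by metis
  obtain z where z: "y = \<varpi> ^ v * z" using y[OF v(1)] by (auto elim: dvdE)
  have "(\<varpi> :: 'p padic_int) ^ n dvd of_nat (CARD('p) ^ v * (CARD('p) ^ n choose j))"
    using v(2) by (simp only: padic_p_power_dvd_of_nat_iff)
  then have "\<varpi> ^ n dvd of_nat (CARD('p) ^ v * (CARD('p) ^ n choose j)) * z" by (rule dvd_mult2)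
  then show ?thesis by (simp add: z padic_p_def ac_simps)
qed

text \<open>By Newton's formula the difference of order \<open>p ^ s\<close> is the step difference
  with step \<open>p ^ s\<close> minus terms of lower order. The induction hypothesis makes these
  divisible; differences of higher order inherit the divisibility.\<close>

lemma fwd_diff_dvd_of_compatible:
  fixes F :: "nat \<Rightarrow> 'p::prime_card padic_int"
  assumes F: "\<And>n x. \<varpi> ^ n dvd step_diff (CARD('p) ^ n) F x"
    and "CARD('p) ^ s \<le> j"
  shows "\<varpi> ^ s dvd (fwd_diff ^^ j) F x"
  using assms(2)
proof (induction s arbitrary: j x rule: less_induct)
  case (less s)
  define h where "h = CARD('p) ^ s"
  have h: "h > 0" by (simp add: h_def)
  have "\<varpi> ^ s dvd (fwd_diff ^^ h) F x" for x
  proof -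
    have *: "\<varpi> ^ s dvd of_nat (h choose i) * (fwd_diff ^^ i) F x" if i: "i \<in> {1..<h}" for i
      unfolding h_def
    proof (rule padic_p_power_dvd_binomial_mult)
      fix t assume t: "CARD('p) ^ t \<le> i"
      then have "CARD('p) ^ t < CARD('p) ^ s" using i by (simp add: h_def)
      then have "t < s" using CARD_gt_1[where 'p='p] by simp
      then show "\<varpi> ^ t dvd (fwd_diff ^^ i) F x" using t by (rule less.IH)
    qed (use i in simp)
    have "{1..h} = insert h {1..<h}" using h by auto
    then have "(fwd_diff ^^ h) F x
        = step_diff h F x - (\<Sum>i=1..<h. of_nat (h choose i) * (fwd_diff ^^ i) F x)"
      by (simp add: step_diff_eq_sum)
    then show ?thesis
      using F[of s x] * by (auto simp: h_def intro!: dvd_diff dvd_sum)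
  qed
  then have "\<varpi> ^ s dvd (fwd_diff ^^ (j - h)) ((fwd_diff ^^ h) F) x"
    by (rule fwd_diff_funpow_dvd)
  then have "\<varpi> ^ s dvd (fwd_diff ^^ (j - h + h)) F x"
    by (simp only: funpow_add comp_apply)
  then show ?case using less.prems by (simp add: h_def)
qed

section \<open>Divisibility of second and third differences with step \<open>p ^ n\<close>\<close>

context
  fixes F :: "nat \<Rightarrow> 'p::prime_card padic_int" and n :: nat
  assumes log: "\<And>s j x. CARD('p) ^ s \<le> j \<Longrightarrow> \<varpi> ^ s dvd (fwd_diff ^^ j) F x"
begin

text \<open>In each term one binomial coefficient together with the difference yields
  \<open>p ^ n\<close> by \<open>log\<close>. The other yields one more \<open>p\<close> unless its
  index is \<open>p ^ n\<close>; if both indices are \<open>p ^ n\<close>, the order is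
  \<open>2 * p ^ n\<close> and \<open>two\<close> applies.\<close>

lemma step_diff_funpow2_dvd:
  assumes two: "\<And>j x. 2 * CARD('p) ^ n \<le> j \<Longrightarrow> \<varpi> ^ (n + 1) dvd (fwd_diff ^^ j) F x"
  shows "\<varpi> ^ (n + 1) dvd (step_diff (CARD('p) ^ n) ^^ 2) F x"
proof (rule step_diff_funpow2_dvdI)
  define h where "h = CARD('p) ^ n"
  fix i j assume ij: "i \<in> {1..CARD('p) ^ n}" "j \<in> {1..CARD('p) ^ n}"
  define y where "y = (fwd_diff ^^ (i + j)) F x"
  have A: "\<varpi> ^ n dvd of_nat (h choose l) * y" if "l \<in> {i, j}" for l
    unfolding h_def by (rule padic_p_power_dvd_binomial_mult) (use that ij log in \<open>auto simp: y_def\<close>)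
  have B: "\<varpi> dvd (of_nat (h choose l) :: 'p padic_int)" if "l \<in> {i, j}" "l \<noteq> h" for l
    using prime_dvd_binomial_prime_power[OF CARD_prime[where 'p='p], of l n] that ij
      padic_p_power_dvd_of_nat_iff[of 1 "h choose l", where 'p='p] by (auto simp: h_def)
  consider "i = h" "j = h" | "i \<noteq> h" | "j \<noteq> h" by blast
  then have "\<varpi> ^ (n + 1) dvd of_nat (h choose i) * (of_nat (h choose j) * y)"
  proof cases
    case 1
    then have "\<varpi> ^ (n + 1) dvd y" unfolding y_def by (intro two) (simp add: h_def)
    then show ?thesis by (intro dvd_mult)
  next
    case 2
    have "\<varpi> * \<varpi> ^ n dvd of_nat (h choose i) * (of_nat (h choose j) * y)"
      by (rule mult_dvd_mono) (use 2 A B in auto)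
    then show ?thesis by simp
  next
    case 3
    have "\<varpi> * \<varpi> ^ n dvd of_nat (h choose j) * (of_nat (h choose i) * y)"
      by (rule mult_dvd_mono) (use 3 A B in auto)
    then show ?thesis by (simp add: ac_simps)
  qed
  then show "\<varpi> ^ (n + 1) dvd of_nat (CARD('p) ^ n choose i) *
      (of_nat (CARD('p) ^ n choose j) * (fwd_diff ^^ (i + j)) F x)"
    by (simp add: y_def h_def)
qed

text \<open>The terms are sorted by how many indices differ from \<open>p ^ n\<close>, each such
  index giving a factor \<open>p\<close>. Two of them are combined with \<open>log\<close>, exactly
  one with \<open>two\<close>, and if there is none \<open>three\<close> applies.\<close>

lemma step_diff_funpow3_dvd:
  assumes two: "\<And>j x. 2 * CARD('p) ^ n \<le> j \<Longrightarrow> \<varpi> ^ (n + 1) dvd (fwd_diff ^^ j) F x"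
    and three: "\<And>j x. 3 * CARD('p) ^ n \<le> j \<Longrightarrow> \<varpi> ^ (n + 2) dvd (fwd_diff ^^ j) F x"
  shows "\<varpi> ^ (n + 2) dvd (step_diff (CARD('p) ^ n) ^^ 3) F x"
proof (rule step_diff_funpow3_dvdI)
  define h where "h = CARD('p) ^ n"
  fix i j l assume ijl: "i \<in> {1..CARD('p) ^ n}" "j \<in> {1..CARD('p) ^ n}" "l \<in> {1..CARD('p) ^ n}"
  define y where "y = (fwd_diff ^^ (i + j + l)) F x"
  define c :: "nat \<Rightarrow> 'p padic_int" where "c k = of_nat (h choose k)" for k
  have A: "\<varpi> ^ n dvd c k * y" if "k \<in> {i, j, l}" for k
    unfolding h_def c_def by (rule padic_p_power_dvd_binomial_mult) (use that ijl log in \<open>auto simp: y_def\<close>)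
  have B: "\<varpi> dvd c k" if "k \<in> {i, j, l}" "k \<noteq> h" for k
    using prime_dvd_binomial_prime_power[OF CARD_prime[where 'p='p], of k n] that ijl
      padic_p_power_dvd_of_nat_iff[of 1 "h choose k", where 'p='p] by (auto simp: h_def c_def)
  have two': "\<varpi> ^ (n + 1) dvd y" if "i + j + l \<ge> 2 * h"
    using that unfolding y_def by (intro two) (simp add: h_def)
  have AB: "\<varpi> ^ (n + 2) dvd c u * (c v * (c w * y))"
    if "u \<noteq> h" "v \<noteq> h" "u \<in> {i, j, l}" "v \<in> {i, j, l}" "w \<in> {i, j, l}" for u v w
  proof -
    have "\<varpi> * (\<varpi> * \<varpi> ^ n) dvd c u * (c v * (c w * y))"
      by (intro mult_dvd_mono A B that)
    then show ?thesis by simp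
  qed
  have CB: "\<varpi> ^ (n + 2) dvd c u * (c v * (c w * y))"
    if "u \<noteq> h" "i + j + l \<ge> 2 * h" "u \<in> {i, j, l}" for u v w
  proof -
    have "\<varpi> * \<varpi> ^ (n + 1) dvd c u * (c v * (c w * y))"
      using that by (intro mult_dvd_mono B dvd_mult two')
    then show ?thesis by simp
  qed
  have "\<varpi> ^ (n + 2) dvd c i * (c j * (c l * y))"
  proof -
    consider "i = h" "j = h" "l = h" | "i \<noteq> h" "j = h" "l = h" | "i = h" "j \<noteq> h" "l = h"
      | "i = h" "j = h" "l \<noteq> h" | "i \<noteq> h" "j \<noteq> h" | "i \<noteq> h" "l \<noteq> h" | "j \<noteq> h" "l \<noteq> h" by blast
    then show ?thesis
    proof cases
      case 1
      then have "\<varpi> ^ (n + 2) dvd y" unfolding y_def by (intro three) (simp add: h_def)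
      then show ?thesis by (intro dvd_mult)
    next
      case 2 then show ?thesis using CB[of i j l] by simp
    next
      case 3 then show ?thesis using CB[of j i l] by (simp add: ac_simps)
    next
      case 4 then show ?thesis using CB[of l i j] by (simp add: ac_simps)
    next
      case 5 then show ?thesis using AB[of i j l] by simp
    next
      case 6 then show ?thesis using AB[of i l j] by (simp add: ac_simps)
    next
      case 7 then show ?thesis using AB[of j l i] by (simp add: ac_simps)
    qed
  qed
  then show "\<varpi> ^ (n + 2) dvd of_nat (CARD('p) ^ n choose i) * (of_nat (CARD('p) ^ n choose j) *
      (of_nat (CARD('p) ^ n choose l) * (fwd_diff ^^ (i + j + l)) F x))"
    by (simp add: y_def h_def c_def)
qed

text \<open>Going from step \<open>p ^ n\<close> to \<open>p ^ Suc n\<close> gains one power of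
  \<open>p\<close> over \<open>step_diff_funpow2_dvd\<close>. This gain is what kills the quadratic
  term when \<open>p = 3\<close>.\<close>

lemma step_diff_funpow2_dvd_Suc:
  assumes p: "CARD('p) > 2"
    and two: "\<And>j x. 2 * CARD('p) ^ n \<le> j \<Longrightarrow> \<varpi> ^ (n + 1) dvd (fwd_diff ^^ j) F x"
    and three: "\<And>j x. 3 * CARD('p) ^ n \<le> j \<Longrightarrow> \<varpi> ^ (n + 2) dvd (fwd_diff ^^ j) F x"
    and twoS: "\<And>j x. 2 * CARD('p) ^ Suc n \<le> j \<Longrightarrow> \<varpi> ^ (n + 3) dvd (fwd_diff ^^ j) F x"
  shows "\<varpi> ^ (n + 3) dvd (step_diff (CARD('p) ^ Suc n) ^^ 2) F x"
proof (rule step_diff_funpow2_dvdI)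
  define h where "h = CARD('p) ^ Suc n"
  define h' where "h' = CARD('p) ^ n"
  fix i j assume ij: "i \<in> {1..CARD('p) ^ Suc n}" "j \<in> {1..CARD('p) ^ Suc n}"
  define y where "y = (fwd_diff ^^ (i + j)) F x"
  define c :: "nat \<Rightarrow> 'p padic_int" where "c k = of_nat (h choose k)" for k
  have A: "\<varpi> ^ Suc n dvd c l * y" if "l \<in> {i, j}" for l
    unfolding h_def c_def by (rule padic_p_power_dvd_binomial_mult) (use that ij log in \<open>auto simp: y_def\<close>)
  have B: "\<varpi> dvd c l" if "l \<in> {i, j}" "l \<noteq> h" for l
    using prime_dvd_binomial_prime_power[OF CARD_prime[where 'p='p], of l "Suc n"] that ij
      padic_p_power_dvd_of_nat_iff[of 1 "h choose l", where 'p='p] by (auto simp: h_def c_def)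
  \<comment> \<open>If \<open>p ^ n\<close> does not divide \<open>l\<close>, then \<open>p\<close>
    occurs in \<open>l\<close> at most \<open>n - 1\<close> times, and at least twice in
    \<open>p ^ Suc n choose l\<close>. For \<open>n = 0\<close> the case is vacuous.\<close>
  have B2: "\<varpi> ^ 2 dvd c l" if l: "l \<in> {i, j}" "\<not> h' dvd l" for l
  proof (cases n)
    case (Suc m)
    have "CARD('p) ^ (Suc n - m) dvd (CARD('p) ^ Suc n choose l)"
      by (rule prime_power_diff_dvd_binomial[OF CARD_prime[where 'p='p]])
        (use l ij Suc in \<open>auto simp: h'_def\<close>)
    then show ?thesis
      using padic_p_power_dvd_of_nat_iff[of 2 "h choose l", where 'p='p]
      by (auto simp: h_def c_def Suc numeral_2_eq_2)
  qed (use l in \<open>simp add: h'_def\<close>)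
  have one: "\<varpi> ^ (n + 3) dvd c u * (c v * y)" if "u \<in> {i, j}" "v \<in> {i, j}" "\<not> h' dvd u" for u v
  proof -
    have "\<varpi> ^ 2 * \<varpi> ^ Suc n dvd c u * (c v * y)"
      using that by (intro mult_dvd_mono A B2)
    then show ?thesis by (simp add: power_add numeral_3_eq_3 numeral_2_eq_2 ac_simps)
  qed
  have ge: "h' \<le> l" if "h' dvd l" "l \<in> {i, j}" for l
    using that ij by (auto intro: dvd_imp_le)
  \<comment> \<open>With one index equal to \<open>h\<close>, the order is at least
    \<open>3 * p ^ n\<close>, so \<open>three\<close> is available; this rests on
    \<open>p > 2\<close>.\<close>
  have hh: "h \<ge> 3 * h'" using p by (simp add: h_def h'_def)
  have mixed: "\<varpi> ^ (n + 3) dvd c u * y" if "u \<noteq> h" "u \<in> {i, j}" "h \<in> {i, j}" for u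
  proof -
    have "\<varpi> ^ (n + 2) dvd y" unfolding y_def
      by (rule three) (use that hh in \<open>auto simp: h'_def\<close>)
    then have "\<varpi> * \<varpi> ^ (n + 2) dvd c u * y"
      using that by (intro mult_dvd_mono B)
    then show ?thesis by (simp add: power_add numeral_3_eq_3 numeral_2_eq_2)
  qed
  have "\<varpi> ^ (n + 3) dvd c i * (c j * y)"
  proof -
    consider "\<not> h' dvd i" | "\<not> h' dvd j" | "i = h" "j = h" | "i \<noteq> h" "j = h" | "i = h" "j \<noteq> h"
      | "h' dvd i" "h' dvd j" "i \<noteq> h" "j \<noteq> h" by blast
    then show ?thesis
    proof cases
      case 1 then show ?thesis using one[of i j] by simp
    next
      case 2 then show ?thesis using one[of j i] by (simp add: ac_simps)
    next
      case 3
      then have "\<varpi> ^ (n + 3) dvd y" unfolding y_def by (intro twoS) (simp add: h_def)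
      then show ?thesis by (intro dvd_mult)
    next
      case 4
      then have "\<varpi> ^ (n + 3) dvd c j * (c i * y)" by (intro dvd_mult mixed) auto
      then show ?thesis by (simp add: ac_simps)
    next
      case 5
      then show ?thesis by (intro dvd_mult mixed) auto
    next
      case 6
      have "\<varpi> ^ (n + 1) dvd y" unfolding y_def
        by (rule two) (use ge[of i] ge[of j] 6 in \<open>simp add: h'_def\<close>)
      then have "\<varpi> * (\<varpi> * \<varpi> ^ (n + 1)) dvd c i * (c j * y)"
        using 6 by (intro mult_dvd_mono B) auto
      then show ?thesis by (simp add: power_add numeral_3_eq_3)
    qed
  qed
  then show "\<varpi> ^ (n + 3) dvd of_nat (CARD('p) ^ Suc n choose i) *
      (of_nat (CARD('p) ^ Suc n choose j) * (fwd_diff ^^ (i + j)) F x)"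
    by (simp add: y_def h_def c_def)
qed

end

subsection \<open>Lifting transitivity\<close>

text \<open>For \<open>p = 3\<close> the quadratic term has to vanish, because \<open>\<Sum>i<3. i\<^sup>2 = 5\<close> is not divisible
  by \<open>3\<close>.\<close>

definition quad_approx :: "('p::prime_card padic_int \<Rightarrow> 'p padic_int) \<Rightarrow> nat \<Rightarrow> bool" where
  "quad_approx f n \<longleftrightarrow> (\<forall>x. \<exists>A B. (CARD('p) = 3 \<longrightarrow> \<varpi> dvd B) \<and>
     (\<forall>t. \<varpi> ^ (n + 2) dvd f (x + \<varpi> ^ n * t) - (f x + \<varpi> ^ n * (A * t + \<varpi> * B * t\<^sup>2))))"

lemma quad_approx_comp:
  fixes f g :: "'p::prime_card padic_int \<Rightarrow> 'p padic_int"
  assumes "compatible f" "quad_approx f n" "quad_approx g n"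
  shows "quad_approx (f \<circ> g) n"
  unfolding quad_approx_def
proof
  fix x
  obtain A B where g: "CARD('p) = 3 \<longrightarrow> \<varpi> dvd B"
    "\<And>t. \<varpi> ^ (n + 2) dvd g (x + \<varpi> ^ n * t) - (g x + \<varpi> ^ n * (A * t + \<varpi> * B * t\<^sup>2))"
    using assms(3) unfolding quad_approx_def by blast
  obtain A' B' where f: "CARD('p) = 3 \<longrightarrow> \<varpi> dvd B'"
    "\<And>t. \<varpi> ^ (n + 2) dvd f (g x + \<varpi> ^ n * t) - (f (g x) + \<varpi> ^ n * (A' * t + \<varpi> * B' * t\<^sup>2))"
    using assms(2) unfolding quad_approx_def by blast
  show "\<exists>A B. (CARD('p) = 3 \<longrightarrow> \<varpi> dvd B) \<and>
     (\<forall>t. \<varpi> ^ (n + 2) dvd (f \<circ> g) (x + \<varpi> ^ n * t) - ((f \<circ> g) x + \<varpi> ^ n * (A * t + \<varpi> * B * t\<^sup>2)))"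
  \<comment> \<open>The witnesses are the coefficients of \<open>t\<close> and
    \<open>\<varpi> * t ^ 2\<close> after substituting
    \<open>u = A * t + \<varpi> * B * t ^ 2\<close> into
    \<open>A' * u + \<varpi> * B' * u ^ 2\<close>. The remaining terms carry
    \<open>\<varpi> ^ 2\<close> and vanish modulo \<open>\<varpi> ^ (n + 2)\<close>.\<close>
  proof (rule exI[of _ "A' * A"], rule exI[of _ "A' * B + B' * A\<^sup>2"], intro conjI impI allI)
    show "\<varpi> dvd A' * B + B' * A\<^sup>2" if "CARD('p) = 3"
      using that f g by auto
  next
    fix t
    define u where "u = A * t + \<varpi> * B * t\<^sup>2"
    have 1: "\<varpi> ^ (n + 2) dvd f (g (x + \<varpi> ^ n * t)) - f (g x + \<varpi> ^ n * u)"
      unfolding u_def by (rule compatibleD[OF assms(1) g(2)])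
    have "f (g (x + \<varpi> ^ n * t)) - (f (g x) + \<varpi> ^ n * (A' * A * t + \<varpi> * (A' * B + B' * A\<^sup>2) * t\<^sup>2))
      = (f (g (x + \<varpi> ^ n * t)) - f (g x + \<varpi> ^ n * u))
       + (f (g x + \<varpi> ^ n * u) - (f (g x) + \<varpi> ^ n * (A' * u + \<varpi> * B' * u\<^sup>2)))
       + \<varpi> ^ (n + 2) * (B' * (2 * A * B * t ^ 3 + \<varpi> * B\<^sup>2 * t ^ 4))"
      unfolding u_def by (simp add: algebra_simps power2_eq_square power3_eq_cube power4_eq_xxxx power_add)
    also have "\<varpi> ^ (n + 2) dvd \<dots>"
      using 1 f(2)[of u] by (intro dvd_add) auto
    finally show "\<varpi> ^ (n + 2) dvd (f \<circ> g) (x + \<varpi> ^ n * t) -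
        ((f \<circ> g) x + \<varpi> ^ n * (A' * A * t + \<varpi> * (A' * B + B' * A\<^sup>2) * t\<^sup>2))"
      by simp
  qed
qed

lemma quad_approx_funpow:
  fixes f :: "'p::prime_card padic_int \<Rightarrow> 'p padic_int"
  assumes "compatible f" "quad_approx f n"
  shows "quad_approx (f ^^ j) n"
proof (induction j)
  case 0
  show ?case unfolding quad_approx_def
    by (rule allI, rule exI[of _ 1], rule exI[of _ 0]) simp
next
  case (Suc j)
  then show ?case using quad_approx_comp[OF assms] by (simp only: funpow.simps)
qed

section \<open>Arithmetic modulo p and the recurrence for the rescaled orbit of 0\<close>

lemma padic_p_dvd_of_nat_iff:
  "(\<varpi> :: 'p::prime_card padic_int) dvd of_nat m \<longleftrightarrow> CARD('p) dvd m"
  using padic_p_power_dvd_of_nat_iff[of 1 m, where 'p='p] by simp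

lemma padic_p_dvd_mult_iff:
  "(\<varpi> :: 'p::prime_card padic_int) dvd a * b \<longleftrightarrow> \<varpi> dvd a \<or> \<varpi> dvd b"
  by (rule prime_elem_dvd_mult_iff[OF prime_elem_padic_p])

lemma padic_fermat:
  fixes A :: "'p::prime_card padic_int"
  shows "\<varpi> dvd A ^ CARD('p) - A"
proof -
  define p where "p = CARD('p)"
  have p: "prime p" using CARD_prime[where 'p='p] by (simp add: p_def)
  obtain m where m: "\<varpi> dvd A - of_nat m" using ex_nat_padic_cong[of 1 A] by auto
  have "[int m ^ p = int m] (mod int p)"
  proof (cases "p dvd m")
    case True
    then show ?thesis using p by (simp add: cong_def zero_power prime_gt_0_nat dvd_power_same
          mod_eq_0_iff_dvd prime_dvd_power_iff)
  next
    case False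
    have "[m ^ (p - 1) * m = 1 * m] (mod p)"
      using fermat_theorem[OF p False] by (rule cong_scalar_right)
    then have "[m ^ p = m] (mod p)"
      using power_minus_mult[of p m] prime_gt_0_nat[OF p] by simp
    then show ?thesis by (simp flip: cong_int_iff)
  qed
  then have "padic_res (of_nat (m ^ p) :: 'p padic_int) 1 = padic_res (of_nat m :: 'p padic_int) 1"
    by (simp only: padic_res_of_nat cong_def p_def) simp
  then have "\<varpi> dvd of_nat m ^ p - (of_nat m :: 'p padic_int)"
    using padic_p_power_dvd_diff_iff[of 1 "of_nat (m ^ p) :: 'p padic_int" "of_nat m"] by simp
  moreover have "\<varpi> dvd A ^ p - of_nat m ^ p"
    using m by (metis dvd_trans power_diff_sumr2 dvd_triv_left)
  ultimately have "\<varpi> dvd (A ^ p - of_nat m ^ p) + (of_nat m ^ p - of_nat m) - (A - of_nat m)"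
    using m by (meson dvd_diff dvd_add)
  then show ?thesis by (simp add: p_def)
qed

text \<open>The power sums are stated without division or subtraction, so that they can be read
  modulo \<open>p\<close> once 2 or 6 is known to be invertible.\<close>

lemma sum_lessThan_times_2: "2 * (\<Sum>i<j. i) + j = (j::nat)\<^sup>2"
  by (induction j) (auto simp: power2_eq_square)

lemma sum_squares_lessThan_times_6: "6 * (\<Sum>i<j. i\<^sup>2) + 3 * j\<^sup>2 = 2 * (j::nat) ^ 3 + j"
  by (induction j) (auto simp: power2_eq_square power3_eq_cube algebra_simps)

text \<open>Modulo \<open>p\<close> the recurrence is affine, and \<open>p\<close> dividing
  \<open>t p\<close> forces \<open>A\<close> to be 1 modulo \<open>p\<close>. Then
  \<open>t j\<close> is \<open>j * b\<close> modulo \<open>p\<close>, and feeding this back gives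
  \<open>t j\<close> modulo \<open>p ^ 2\<close> with corrections that are power sums. These vanish
  when \<open>p\<close> divides \<open>j\<close>, and \<open>b\<close> is a unit.\<close>

lemma quadratic_recurrence:
  fixes t :: "nat \<Rightarrow> 'p::prime_card padic_int"
  assumes odd: "odd CARD('p)" and B3: "CARD('p) = 3 \<Longrightarrow> \<varpi> dvd B"
    and t0: "t 0 = 0" and tS: "\<And>j. t (Suc j) = b + A * t j + \<varpi> * B * (t j)\<^sup>2"
    and t_dvd: "\<And>j. \<varpi> dvd t j \<longleftrightarrow> CARD('p) dvd j"
  shows "\<varpi>\<^sup>2 dvd t j \<longleftrightarrow> CARD('p)\<^sup>2 dvd j"
proof -
  have p3: "CARD('p) > 2"
    using CARD_gt_1[where 'p='p] odd by (cases "CARD('p) = 2") auto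
  have b: "\<not> \<varpi> dvd b"
    using t_dvd[of 1] tS[of 0] p3 by (simp add: t0)
  \<comment> \<open>This is the geometric sum formula for the affine recurrence, multiplied by
    \<open>A - 1\<close> to avoid a division. At \<open>j = p\<close>, Fermat's theorem turns it
    into the congruence of \<open>A\<close> with 1.\<close>
  have "\<varpi> dvd (A - 1) * t j - b * (A ^ j - 1)" for j
  proof (induction j)
    case (Suc j)
    have "(A - 1) * t (Suc j) - b * (A ^ Suc j - 1)
        = A * ((A - 1) * t j - b * (A ^ j - 1)) + \<varpi> * ((A - 1) * B * (t j)\<^sup>2)"
      by (simp add: tS algebra_simps)
    then show ?case using Suc by simp
  qed (simp add: t0)
  from this[of "CARD('p)"] have "\<varpi> dvd b * (A ^ CARD('p) - 1)"
    using t_dvd[of "CARD('p)"] by (metis dvd_mult dvd_refl dvd_diff_right_iff)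
  then have "\<varpi> dvd A ^ CARD('p) - 1" using b by (simp add: padic_p_dvd_mult_iff)
  from dvd_diff[OF this padic_fermat[of A]] have "\<varpi> dvd A - 1" by simp
  then obtain c where c: "A = 1 + \<varpi> * c" by (metis add.commute diff_add_cancel dvdE)
  have lin: "\<varpi> dvd t j - of_nat j * b" for j
  proof (induction j)
    case (Suc j)
    have "t (Suc j) - of_nat (Suc j) * b = (t j - of_nat j * b) + \<varpi> * (c * t j + B * (t j)\<^sup>2)"
      by (simp add: tS c algebra_simps)
    then show ?case using Suc by simp
  qed (simp add: t0)
  define S1 S2 :: "nat \<Rightarrow> 'p padic_int"
    where "S1 j = of_nat (\<Sum>i<j. i)" and "S2 j = of_nat (\<Sum>i<j. i\<^sup>2)" for j
  have quad: "\<varpi>\<^sup>2 dvd t j - (of_nat j * b + \<varpi> * (c * b * S1 j + B * b\<^sup>2 * S2 j))" for j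
  proof (induction j)
    case (Suc j)
    obtain z where z: "t j = of_nat j * b + \<varpi> * z"
      using lin[of j] by (metis add.commute diff_add_cancel dvdE)
    have "t (Suc j) - (of_nat (Suc j) * b + \<varpi> * (c * b * S1 (Suc j) + B * b\<^sup>2 * S2 (Suc j)))
      = (t j - (of_nat j * b + \<varpi> * (c * b * S1 j + B * b\<^sup>2 * S2 j)))
        + \<varpi> * (c * (t j - of_nat j * b) + B * ((t j)\<^sup>2 - (of_nat j * b)\<^sup>2))"
      by (simp add: tS c S1_def S2_def algebra_simps power_mult_distrib)
    also have "\<varpi> * (c * (t j - of_nat j * b) + B * ((t j)\<^sup>2 - (of_nat j * b)\<^sup>2))
      = \<varpi>\<^sup>2 * (c * z + B * (2 * of_nat j * b * z + \<varpi> * z\<^sup>2))"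
      by (simp add: z algebra_simps power2_eq_square)
    finally show ?case using Suc by simp
  qed (simp add: t0 S1_def S2_def)
  have num: "\<not> CARD('p) dvd 2" using p3 by (auto dest: dvd_imp_le)
  have S1: "\<varpi> dvd S1 j" if "CARD('p) dvd j" for j
  proof -
    have "CARD('p) dvd 2 * (\<Sum>i<j. i)"
      using that sum_lessThan_times_2[of j] by (metis dvd_add_left_iff dvd_power_same dvd_mult power2_eq_square)
    then have "CARD('p) dvd (\<Sum>i<j. i)"
      using num CARD_prime[where 'p='p] prime_dvd_mult_iff by blast
    then show ?thesis by (simp add: S1_def padic_p_dvd_of_nat_iff del: of_nat_sum)
  qed
  have S2: "\<varpi> dvd B * S2 j" if "CARD('p) dvd j" for j
  \<comment> \<open>The sum of squares is divisible by \<open>p\<close> only when 6 is invertible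
    modulo \<open>p\<close>; for \<open>p = 3\<close> the factor comes from \<open>B\<close>
    instead.\<close>
  proof (cases "CARD('p) = 3")
    case False
    have "\<not> CARD('p) dvd 3"
      using False primes_dvd_imp_eq[OF CARD_prime[where 'p='p], of 3] by auto
    then have num6: "\<not> CARD('p) dvd 6"
      using num CARD_prime[where 'p='p] prime_dvd_mult_iff[of "CARD('p)" 2 3] by simp
    have "CARD('p) dvd 6 * (\<Sum>i<j. i\<^sup>2) + 3 * j\<^sup>2"
      unfolding sum_squares_lessThan_times_6 using that by (simp add: power3_eq_cube)
    moreover have "CARD('p) dvd 3 * j\<^sup>2" using that by (simp add: power2_eq_square)
    ultimately have "CARD('p) dvd 6 * (\<Sum>i<j. i\<^sup>2)" by (metis dvd_add_left_iff)
    then have "CARD('p) dvd (\<Sum>i<j. i\<^sup>2)"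
      using num6 CARD_prime[where 'p='p] prime_dvd_mult_iff by blast
    then have "\<varpi> dvd S2 j" by (simp only: S2_def padic_p_dvd_of_nat_iff)
    then show ?thesis by simp
  qed (use B3 in simp)
  have tj: "\<varpi>\<^sup>2 dvd t j - of_nat j * b" if "CARD('p) dvd j" for j
  proof -
    have "\<varpi> dvd c * b * S1 j + b\<^sup>2 * (B * S2 j)" using S1[OF that] S2[OF that] by simp
    then have "\<varpi> * \<varpi> dvd \<varpi> * (c * b * S1 j + B * b\<^sup>2 * S2 j)"
      by (intro mult_dvd_mono) (simp_all add: ac_simps)
    from dvd_add[OF quad[of j] this[folded power2_eq_square]] show ?thesis by simp
  qed
  show ?thesis
  proof
    assume t: "\<varpi>\<^sup>2 dvd t j"
    then have "\<varpi> dvd t j" unfolding power2_eq_square by (rule dvd_mult_left)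
    then have "CARD('p) dvd j" using t_dvd by simp
    then obtain i where i: "j = CARD('p) * i" ..
    have "\<varpi>\<^sup>2 dvd t j - (t j - of_nat j * b)"
      using t tj[OF \<open>CARD('p) dvd j\<close>] by (rule dvd_diff)
    then have "\<varpi> * \<varpi> dvd \<varpi> * (of_nat i * b)"
      by (simp add: i padic_p_def power2_eq_square ac_simps)
    then have "\<varpi> dvd of_nat i * b" by (simp only: dvd_mult_cancel_left) simp
    then have "CARD('p) dvd i" using b by (simp add: padic_p_dvd_mult_iff padic_p_dvd_of_nat_iff)
    then show "CARD('p)\<^sup>2 dvd j" by (simp add: i power2_eq_square)
  next
    assume j: "CARD('p)\<^sup>2 dvd j"
    then have "\<varpi>\<^sup>2 dvd (of_nat j :: 'p padic_int)" by (simp only: padic_p_power_dvd_of_nat_iff)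
    then have "\<varpi>\<^sup>2 dvd (t j - of_nat j * b) + of_nat j * b"
      using tj[of j] j dvd_mult_left[of "CARD('p)" "CARD('p)" j]
      by (intro dvd_add) (auto simp: power2_eq_square)
    then show "\<varpi>\<^sup>2 dvd t j" by simp
  qed
qed

text \<open>The orbit of 0 is divisible by \<open>p ^ n\<close> exactly at the multiples of
  \<open>h\<close>, so only the iterates of \<open>G\<close> matter. Divided by
  \<open>p ^ n\<close>, they follow the quadratic recurrence modulo \<open>p ^ 2\<close>, whose
  return times are known.\<close>

lemma minimal_mod_lift:
  fixes f :: "'p::prime_card padic_int \<Rightarrow> 'p padic_int"
  assumes odd: "odd CARD('p)" and f: "compatible f" and qa: "quad_approx f n"
    and min: "minimal_mod f (n + 1)"
  shows "minimal_mod f (n + 2)"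
proof -
  define h where "h = CARD('p) ^ n"
  define G where "G = f ^^ h"
  have T1: "\<varpi> ^ (n + 1) dvd (f ^^ j) 0 \<longleftrightarrow> CARD('p) ^ (n + 1) dvd j" for j
    using minimal_mod_iff[OF f] min by blast
  have T0: "\<varpi> ^ n dvd (f ^^ j) 0 \<longleftrightarrow> h dvd j" for j
    using minimal_mod_iff[OF f] minimal_mod_antimono[OF min, of n] unfolding h_def by simp
  obtain b where b: "G 0 = \<varpi> ^ n * b" using T0[of h] unfolding G_def by (auto elim: dvdE)
  have "quad_approx G n" unfolding G_def by (rule quad_approx_funpow[OF f qa])
  then obtain A B where B3: "CARD('p) = 3 \<longrightarrow> \<varpi> dvd B"
    and G: "\<And>t. \<varpi> ^ (n + 2) dvd G (0 + \<varpi> ^ n * t) - (G 0 + \<varpi> ^ n * (A * t + \<varpi> * B * t\<^sup>2))"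
    unfolding quad_approx_def by blast
  \<comment> \<open>An exact solution of the recurrence, which models the orbit of 0 under
    \<open>G\<close> divided by \<open>p ^ n\<close>; the two agree only modulo
    \<open>p ^ 2\<close>.\<close>
  define t where "t = rec_nat 0 (\<lambda>_ s. b + A * s + \<varpi> * B * s\<^sup>2)"
  have t0: "t 0 = 0" and tS: "t (Suc j) = b + A * t j + \<varpi> * B * (t j)\<^sup>2" for j
    by (simp_all add: t_def)
  have approx: "\<varpi> ^ (n + 2) dvd (G ^^ j) 0 - \<varpi> ^ n * t j" for j
  proof (induction j)
    case (Suc j)
    have "\<varpi> ^ (n + 2) dvd G ((G ^^ j) 0) - G (\<varpi> ^ n * t j)"
      unfolding G_def by (rule compatible_funpowD[OF f Suc[unfolded G_def]])
    from dvd_add[OF this G[of "t j"]] show ?case by (simp add: b tS algebra_simps)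
  qed (simp add: t0)
  have iff: "\<varpi> ^ (n + k) dvd (f ^^ (h * j)) 0 \<longleftrightarrow> \<varpi> ^ k dvd t j" if "k \<le> 2" for j k
  proof -
    have "(f ^^ (h * j)) 0 = (G ^^ j) 0" by (simp add: G_def funpow_mult)
    moreover have "\<varpi> ^ (n + k) dvd (G ^^ j) 0 - \<varpi> ^ n * t j"
      using approx[of j] that by (meson add_left_mono dvd_trans le_imp_power_dvd)
    ultimately have "\<varpi> ^ (n + k) dvd (f ^^ (h * j)) 0 \<longleftrightarrow> \<varpi> ^ (n + k) dvd \<varpi> ^ n * t j"
      by (metis dvd_add_right_iff diff_add_cancel)
    also have "\<dots> \<longleftrightarrow> \<varpi> ^ k dvd t j"
      by (simp add: power_add)
    finally show ?thesis .
  qed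
  have t_dvd: "\<varpi> dvd t j \<longleftrightarrow> CARD('p) dvd j" for j
    using iff[of 1 j] T1[of "h * j"] by (simp add: h_def)
  have t2: "\<varpi>\<^sup>2 dvd t j \<longleftrightarrow> CARD('p)\<^sup>2 dvd j" for j
    using quadratic_recurrence[OF odd _ t0 tS t_dvd] B3 by blast
  have "\<varpi> ^ (n + 2) dvd (f ^^ j) 0 \<longleftrightarrow> CARD('p) ^ (n + 2) dvd j" for j
  proof (cases "h dvd j")
    case True
    then obtain i where "j = h * i" ..
    then show ?thesis using iff[of 2 i] t2[of i] by (simp add: h_def power_add power2_eq_square)
  next
    case False
    then have "\<not> \<varpi> ^ n dvd (f ^^ j) 0" using T0 by simp
    then have "\<not> \<varpi> ^ (n + 2) dvd (f ^^ j) 0" by (meson dvd_trans le_add1 le_imp_power_dvd)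
    moreover have "\<not> CARD('p) ^ (n + 2) dvd j"
      using False unfolding h_def by (meson dvd_trans le_add1 le_imp_power_dvd)
    ultimately show ?thesis by blast
  qed
  then show ?thesis using minimal_mod_iff[OF f] by blast
qed

text \<open>Modulo \<open>p ^ (n + 2)\<close> the second difference is constant along steps of
  \<open>h\<close>, so summing twice gives a quadratic polynomial in \<open>t\<close>. Compatibility
  and density extend this from natural numbers to all arguments.\<close>

lemma quad_approx_of_step_diff:
  fixes f :: "'p::prime_card padic_int \<Rightarrow> 'p padic_int" and n :: nat
  defines "F \<equiv> \<lambda>m. f (of_nat m)" and "h \<equiv> CARD('p) ^ n"
  assumes odd: "odd CARD('p)" and f: "compatible f"
    and d2: "\<And>x. \<varpi> ^ (n + 1) dvd (step_diff h ^^ 2) F x"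
    and d3: "\<And>x. \<varpi> ^ (n + 2) dvd (step_diff h ^^ 3) F x"
    and d2': "\<And>x. CARD('p) = 3 \<Longrightarrow> \<varpi> ^ (n + 2) dvd (step_diff h ^^ 2) F x"
  shows "quad_approx f n"
  unfolding quad_approx_def
proof
  fix x0 :: "'p padic_int"
  obtain x where x: "\<varpi> ^ (n + 2) dvd x0 - of_nat x" using ex_nat_padic_cong by blast
  have h: "of_nat h = (\<varpi> :: 'p padic_int) ^ n" by (simp add: h_def padic_p_def)
  have "padic_res (of_nat 2 :: 'p padic_int) 1 \<noteq> 0"
    using CARD_gt_1[where 'p='p] odd unfolding padic_res_of_nat
    by (cases "CARD('p) = 2") auto
  then obtain w :: "'p padic_int" where w: "of_nat 2 * w = 1" by (rule padic_unit)
  define D1 D2 where "D1 = step_diff h F x" and "D2 = (step_diff h ^^ 2) F x"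
  have e3: "\<varpi> ^ (n + 2) dvd (step_diff h ^^ 2) F (x + h * t) - D2" for t
  proof (induction t)
    case (Suc t)
    have "(step_diff h ^^ 2) F (x + h * Suc t) - (step_diff h ^^ 2) F (x + h * t) = (step_diff h ^^ 3) F (x + h * t)"
      by (simp add: numeral_3_eq_3 numeral_2_eq_2 step_diff_def algebra_simps)
    from dvd_add[OF d3[of "x + h * t", folded this] Suc] show ?case by simp
  qed (simp add: D2_def)
  have e2: "\<varpi> ^ (n + 2) dvd step_diff h F (x + h * t) - (D1 + of_nat t * D2)" for t
  proof (induction t)
    case (Suc t)
    have "step_diff h F (x + h * Suc t) = step_diff h F (x + h * t) + (step_diff h ^^ 2) F (x + h * t)"
      by (simp add: numeral_2_eq_2 step_diff_def algebra_simps)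
    with dvd_add[OF e3[of t] Suc] show ?case by (simp add: algebra_simps)
  qed (simp add: D1_def)
  \<comment> \<open>The factor \<open>w\<close> is the inverse of 2, so the coefficient of
    \<open>D2\<close> is the triangular number \<open>t * (t - 1) / 2\<close>.\<close>
  define Q where "Q t = w * of_nat t * (of_nat t - 1) * D2" for t :: nat
  have Q_Suc: "Q (Suc t) = Q t + of_nat t * D2" for t
  proof -
    have "Q (Suc t) = Q t + (of_nat 2 * w) * (of_nat t * D2)"
      by (simp add: Q_def algebra_simps)
    then show ?thesis by (simp only: w mult_1)
  qed
  have e1: "\<varpi> ^ (n + 2) dvd F (x + h * t) - (F x + of_nat t * D1 + Q t)" for t
  proof (induction t)
    case (Suc t)
    have "F (x + h * Suc t) = F (x + h * t) + step_diff h F (x + h * t)"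
      by (simp add: step_diff_def algebra_simps)
    then show ?case
      using dvd_add[OF e2[of t] Suc] by (simp add: Q_Suc algebra_simps)
  qed (simp add: Q_def)
  have "\<varpi> ^ n dvd f (of_nat (x + h)) - f (of_nat x)"
    by (rule compatibleD[OF f]) (simp add: h)
  then obtain A0 where A0: "D1 = \<varpi> ^ n * A0" by (auto simp: D1_def step_diff_def F_def elim: dvdE)
  obtain B0 where B0: "D2 = \<varpi> ^ (n + 1) * B0" using d2[of x] by (auto simp: D2_def elim: dvdE)
  have B3: "\<varpi> dvd B0" if "CARD('p) = 3"
    using d2'[OF that, of x] by (simp add: B0 power_add flip: D2_def)
  show "\<exists>A B. (CARD('p) = 3 \<longrightarrow> \<varpi> dvd B) \<and>
     (\<forall>t. \<varpi> ^ (n + 2) dvd f (x0 + \<varpi> ^ n * t) - (f x0 + \<varpi> ^ n * (A * t + \<varpi> * B * t\<^sup>2)))"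
  \<comment> \<open>Expanding \<open>t * (t - 1)\<close> in \<open>Q\<close> sends its linear part
    into \<open>A\<close>; the quadratic part gives \<open>B\<close>.\<close>
  proof (rule exI[of _ "A0 - \<varpi> * w * B0"], rule exI[of _ "w * B0"], intro conjI impI allI)
    show "\<varpi> dvd w * B0" if "CARD('p) = 3" using B3[OF that] by simp
    fix t0 :: "'p padic_int"
    define A B where "A = A0 - \<varpi> * w * B0" and "B = w * B0"
    \<comment> \<open>Precision \<open>\<varpi> ^ 2\<close> is enough, because \<open>t0\<close>
      enters multiplied by \<open>\<varpi> ^ n\<close>.\<close>
    obtain t where "\<varpi> ^ 2 dvd t0 - of_nat t" using ex_nat_padic_cong by blast
    then obtain z where z: "t0 = of_nat t + \<varpi> ^ 2 * z" by (metis add.commute diff_add_cancel dvdE)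
    have eq: "x0 + \<varpi> ^ n * t0 - of_nat (x + h * t) = (x0 - of_nat x) + \<varpi> ^ (n + 2) * z"
      by (simp add: z h power_add power2_eq_square algebra_simps)
    have "\<varpi> ^ (n + 2) dvd x0 + \<varpi> ^ n * t0 - of_nat (x + h * t)"
      unfolding eq by (rule dvd_add[OF x dvd_triv_left])
    then have 1: "\<varpi> ^ (n + 2) dvd f (x0 + \<varpi> ^ n * t0) - F (x + h * t)"
      unfolding F_def by (rule compatibleD[OF f])
    have 2: "\<varpi> ^ (n + 2) dvd f x0 - F x"
      unfolding F_def by (rule compatibleD[OF f x])
    have "f (x0 + \<varpi> ^ n * t0) - (f x0 + \<varpi> ^ n * (A * t0 + \<varpi> * B * t0\<^sup>2))
      = (f (x0 + \<varpi> ^ n * t0) - F (x + h * t))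
        + (F (x + h * t) - (F x + of_nat t * D1 + Q t))
        - (f x0 - F x) - \<varpi> ^ (n + 2) * (A * z + \<varpi> * B * z * (t0 + of_nat t))"
      by (simp add: A_def B_def Q_def A0 B0 z power_add power2_eq_square algebra_simps)
    also have "\<varpi> ^ (n + 2) dvd \<dots>"
      by (rule dvd_diff[OF dvd_diff[OF dvd_add[OF 1 e1] 2] dvd_triv_left])
    finally show "\<varpi> ^ (n + 2) dvd f (x0 + \<varpi> ^ n * t0)
        - (f x0 + \<varpi> ^ n * ((A0 - \<varpi> * w * B0) * t0 + \<varpi> * (w * B0) * t0\<^sup>2))"
      by (simp add: A_def B_def)
  qed
qed

subsection \<open>Interpolation series\<close>

lemma padic_binom_of_nat:
  "padic_binom (of_nat m :: 'p::prime_card padic_int) k = of_nat (m choose k)"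
proof -
  have "(\<Prod>i=0..<k. of_nat m - of_nat i :: 'p padic_int) = of_nat ((m choose k) * fact k)"
  proof (cases "k \<le> m")
    case True
    have "(\<Prod>i=0..<k. of_nat m - of_nat i :: 'p padic_int) = of_nat (\<Prod>i=0..<k. m - i)"
      using True by (simp add: of_nat_diff)
    also have "(\<Prod>i=0..<k. m - i) = (m choose k) * fact k"
    proof -
      have "real (\<Prod>i=0..<k. m - i) = (\<Prod>i=0..<k. real m - real i)"
        using True by (simp add: of_nat_diff)
      also have "\<dots> = real ((m choose k) * fact k)"
        using gbinomial_mult_fact'[of "real m" k] by (simp add: binomial_gbinomial)
      finally show ?thesis by (simp only: of_nat_eq_iff)
    qed
    finally show ?thesis .
  next
    case False
    then have "(\<Prod>i=0..<k. of_nat m - of_nat i :: 'p padic_int) = 0"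
      by (intro prod_zero) (auto intro!: bexI[of _ m])
    then show ?thesis using False by (simp add: binomial_eq_0)
  qed
  then have "padic_binom (of_nat m :: 'p padic_int) k * fact k = of_nat (m choose k) * fact k"
    by (simp add: padic_binom_mult_fact)
  then show ?thesis by simp
qed

lemma interpolation_series_of_nat:
  fixes f :: "'p::prime_card padic_int \<Rightarrow> 'p padic_int"
  assumes "(\<lambda>i. a i * padic_binom (of_nat m) i) sums f (of_nat m)"
  shows "f (of_nat m) = (\<Sum>i\<le>m. a i * of_nat (m choose i))"
proof -
  have "(\<lambda>i. a i * of_nat (m choose i)) sums f (of_nat m)"
    using assms by (simp add: padic_binom_of_nat)
  moreover have "(\<lambda>i. a i * of_nat (m choose i)) sums (\<Sum>i\<le>m. a i * of_nat (m choose i))"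
    by (rule sums_finite) (auto simp: binomial_eq_0)
  ultimately show ?thesis by (rule sums_unique2)
qed

text \<open>Clearing the denominator moves the hypothesis from the field of fractions to
  divisibility in the ring of integers.\<close>

lemma fact_dvd_of_padic_norm_le:
  fixes a :: "'p::prime_card padic_int"
  assumes "padic_norm (to_fract a / of_nat (fact i)) \<le> real CARD('p) ^ \<rho>"
  shows "fact i dvd \<varpi> ^ \<rho> * a"
proof (rule padic_dvdI)
  have nz: "(fact i :: 'p padic_int) \<noteq> 0" by simp
  have "to_fract a / of_nat (fact i) = Fract a (fact i :: 'p padic_int)"
    by (simp add: to_fract_def Fract_of_nat_eq[symmetric])
  then have le: "pint_norm a / pint_norm (fact i :: 'p padic_int) \<le> real CARD('p) ^ \<rho>"
    using assms padic_norm_Fract[OF nz, of a] by simp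
  have pos: "pint_norm (fact i :: 'p padic_int) > 0"
    using padic_norm_nonneg[of "fact i :: 'p padic_int"] padic_norm_eq_0_iff[of "fact i :: 'p padic_int"]
    by simp
  have "pint_norm (\<varpi> ^ \<rho> :: 'p padic_int) \<le> 1 / real CARD('p) ^ \<rho>"
    by (simp add: padic_norm_le_iff flip: padic_p_power_dvd_iff)
  then have "pint_norm (\<varpi> ^ \<rho> * a) \<le> 1 / real CARD('p) ^ \<rho> * pint_norm a"
    unfolding padic_norm_mult by (rule mult_right_mono) (rule padic_norm_nonneg)
  also have "\<dots> \<le> pint_norm (fact i :: 'p padic_int)"
    using le pos by (simp add: field_simps)
  finally show "pint_norm (\<varpi> ^ \<rho> * a) \<le> pint_norm (fact i :: 'p padic_int)" .
qed

text \<open>The factors \<open>p, 2 * p, ..., k * p\<close> of \<open>fact (p * k)\<close> multiply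
  to \<open>p ^ k * fact k\<close>.\<close>

lemma power_mult_fact_dvd_fact_mult:
  fixes p :: nat
  assumes "p > 0"
  shows "p ^ k * fact k dvd (fact (p * k) :: nat)"
proof (induction k)
  case (Suc k)
  define q where "q = p * k + (p - 1)"
  have q: "p * Suc k = Suc q" using assms by (simp add: q_def)
  have "p ^ Suc k * fact (Suc k) = (p ^ k * fact k) * (p * Suc k)"
    by (simp add: algebra_simps)
  also have "\<dots> dvd fact (p * k) * (p * Suc k)" by (rule mult_dvd_mono[OF Suc dvd_refl])
  also have "\<dots> dvd fact q * (p * Suc k)"
    by (intro mult_dvd_mono fact_dvd dvd_refl) (simp add: q_def)
  also have "\<dots> = fact (p * Suc k)" unfolding q by simp
  finally show ?case .
qed simp

text \<open>A lower bound of Legendre type, obtained by iterating the previous lemma: raising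
  \<open>n\<close> by one contributes \<open>m * p ^ n\<close> factors \<open>p\<close>.\<close>

lemma power_dvd_fact_mult_power:
  fixes p :: nat
  assumes "p > 0"
  shows "p ^ (m * (\<Sum>i<n. p ^ i)) dvd (fact (m * p ^ n) :: nat)"
proof (induction n)
  case (Suc n)
  have "p ^ (m * (\<Sum>i<Suc n. p ^ i)) = p ^ (m * p ^ n) * p ^ (m * (\<Sum>i<n. p ^ i))"
    by (simp add: distrib_left power_add)
  also have "\<dots> dvd p ^ (m * p ^ n) * fact (m * p ^ n)" by (rule mult_dvd_mono[OF dvd_refl Suc])
  also have "\<dots> dvd fact (p * (m * p ^ n))" by (rule power_mult_fact_dvd_fact_mult[OF assms])
  finally show ?case by (simp add: ac_simps)
qed simp

lemma padic_p_power_dvd_coeff: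
  fixes a :: "'p::prime_card padic_int"
  assumes "fact i dvd \<varpi> ^ \<rho> * a" "m * CARD('p) ^ n \<le> i" "\<rho> + s \<le> m * (\<Sum>i<n. CARD('p) ^ i)"
  shows "\<varpi> ^ s dvd a"
proof -
  have "CARD('p) ^ (\<rho> + s) dvd CARD('p) ^ (m * (\<Sum>i<n. CARD('p) ^ i))"
    using assms(3) by (rule le_imp_power_dvd)
  also have "\<dots> dvd fact (m * CARD('p) ^ n)" by (rule power_dvd_fact_mult_power) simp
  also have "\<dots> dvd fact i" using assms(2) by (rule fact_dvd)
  finally have "(\<varpi> :: 'p padic_int) ^ (\<rho> + s) dvd of_nat (fact i)"
    by (simp only: padic_p_power_dvd_of_nat_iff)
  then have "\<varpi> ^ (\<rho> + s) dvd \<varpi> ^ \<rho> * a" using assms(1) by (simp add: dvd_trans)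
  then show ?thesis by (simp add: power_add)
qed

text \<open>The quotient in the definition is a geometric sum, so the inequality lives in the
  natural numbers. It persists for larger \<open>k\<close>, since a step adds 1 on the left and at
  least 2 on the right.\<close>

lemma lambda_bound_spec:
  fixes p :: nat
  assumes "p \<ge> 2"
  shows "lambda_bound p \<rho> \<ge> 1" "k \<ge> lambda_bound p \<rho> \<Longrightarrow> \<rho> + k < 2 * (\<Sum>i<k. p ^ i)"
proof -
  define L where "L = lambda_bound p \<rho>"
  define e where "e k = (\<Sum>i<k. p ^ i)" for k
  have geo: "(real p ^ k - 1) / (real p - 1) = real (e k)" for k
    using geometric_sum[of "real p" k] assms by (simp add: e_def)
  have iff: "2 * ((real p ^ k - 1) / (real p - 1)) - real k > real \<rho> \<longleftrightarrow> \<rho> + k < 2 * e k" for k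
    unfolding geo by linarith
  have L: "L = (LEAST k. k \<ge> 1 \<and> \<rho> + k < 2 * e k)"
    unfolding L_def lambda_bound_def iff ..
  have ge: "e k \<ge> k" for k
  proof (induction k)
    case (Suc k)
    moreover have "p ^ k \<ge> 1" using assms by simp
    ultimately show ?case unfolding e_def sum.lessThan_Suc by linarith
  qed simp
  \<comment> \<open>A witness is needed for \<open>LEAST\<close> to be meaningful;
    \<open>Suc \<rho>\<close> works because \<open>e k \<ge> k\<close>.\<close>
  have "Suc \<rho> \<ge> 1 \<and> \<rho> + Suc \<rho> < 2 * e (Suc \<rho>)" using ge[of "Suc \<rho>"] by linarith
  then have spec: "L \<ge> 1 \<and> \<rho> + L < 2 * e L" unfolding L by (rule LeastI)
  then show "lambda_bound p \<rho> \<ge> 1" by (simp add: L_def)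
  have "\<rho> + k < 2 * e k" if "k \<ge> L" for k
    using that
  proof (induction k rule: dec_induct)
    case base
    show ?case using spec by simp
  next
    case (step k)
    have "p ^ k \<ge> 1" using assms by simp
    then show ?case using step.IH by (simp add: e_def)
  qed
  then show "k \<ge> lambda_bound p \<rho> \<Longrightarrow> \<rho> + k < 2 * (\<Sum>i<k. p ^ i)"
    by (simp add: L_def e_def)
qed

lemma quad_approx_of_interpolation_series:
  fixes f :: "'p::prime_card padic_int \<Rightarrow> 'p padic_int"
  assumes odd: "odd CARD('p)" and f: "compatible f"
    and ser: "\<And>x. (\<lambda>i. a i * padic_binom x i) sums f x"
    and bound: "\<And>i. padic_norm (to_fract (a i) / of_nat (fact i)) \<le> real CARD('p) ^ \<rho>"
    and n: "lambda_bound CARD('p) \<rho> + (if CARD('p) = 3 then 1 else 0) \<le> n"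
  shows "quad_approx f n"
proof -
  define L where "L = lambda_bound CARD('p) \<rho>"
  define F where "F m = f (of_nat m)" for m
  have p3: "CARD('p) > 2"
    using CARD_gt_1[where 'p='p] odd by (cases "CARD('p) = 2") auto
  have "F = (\<lambda>m. \<Sum>i\<le>m. a i * of_nat (m choose i))"
    unfolding F_def by (intro ext interpolation_series_of_nat ser)
  then have D: "(fwd_diff ^^ j) F x = (\<Sum>i\<le>x. a (i + j) * of_nat (x choose i))" for j x
    by (simp add: fwd_diff_binomial_sum)
  have D_dvd: "\<varpi> ^ s dvd (fwd_diff ^^ j) F x"
    \<comment> \<open>The difference of order \<open>j\<close> involves only coefficients of index
      at least \<open>j\<close>, whose factorials are divisible by a high power of \<open>p\<close>;
      \<open>\<rho>\<close> is the loss permitted by the norm bound.\<close>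
    if "m * CARD('p) ^ k \<le> j" "\<rho> + s \<le> m * (\<Sum>i<k. CARD('p) ^ i)" for m k s j x
  proof -
    have "\<varpi> ^ s dvd a (i + j)" for i
      using fact_dvd_of_padic_norm_le[OF bound] that
      by (intro padic_p_power_dvd_coeff[where i = "i + j" and m = m and n = k]) auto
    then show ?thesis unfolding D by (intro dvd_sum dvd_mult2)
  qed
  have lam: "\<rho> + k + 1 \<le> 2 * (\<Sum>i<k. CARD('p) ^ i)" "(\<Sum>i<k. CARD('p) ^ i) \<ge> 1" if "k \<ge> L" for k
  proof -
    show *: "\<rho> + k + 1 \<le> 2 * (\<Sum>i<k. CARD('p) ^ i)"
      using lambda_bound_spec(2)[of "CARD('p)" \<rho> k] that p3 by (simp add: L_def)
    then show "(\<Sum>i<k. CARD('p) ^ i) \<ge> 1" by linarith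
  qed
  have log: "\<varpi> ^ s dvd (fwd_diff ^^ j) F x" if "CARD('p) ^ s \<le> j" for s j x
  proof (rule fwd_diff_dvd_of_compatible[OF _ that])
    fix n x
    show "\<varpi> ^ n dvd step_diff (CARD('p) ^ n) F x"
      unfolding step_diff_def F_def by (rule compatibleD[OF f]) (simp add: padic_p_def)
  qed
  have two: "\<varpi> ^ (k + 1) dvd (fwd_diff ^^ j) F x" if "k \<ge> L" "2 * CARD('p) ^ k \<le> j" for k j x
    using lam[OF that(1)] by (intro D_dvd[OF that(2)]) simp
  have three: "\<varpi> ^ (k + 2) dvd (fwd_diff ^^ j) F x" if "k \<ge> L" "3 * CARD('p) ^ k \<le> j" for k j x
    using lam[OF that(1)] by (intro D_dvd[OF that(2)]) simp
  have twoS: "\<varpi> ^ (k + 3) dvd (fwd_diff ^^ j) F x" if "k \<ge> L" "2 * CARD('p) ^ Suc k \<le> j" for k j x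
  proof (rule D_dvd[OF that(2)])
    have "CARD('p) ^ k \<ge> 1" by simp
    then show "\<rho> + (k + 3) \<le> 2 * (\<Sum>i<Suc k. CARD('p) ^ i)" using lam(1)[OF that(1)]
      unfolding sum.lessThan_Suc distrib_left by linarith
  qed
  have nL: "n \<ge> L" using n by (simp add: L_def)
  show ?thesis
  proof (rule quad_approx_of_step_diff[OF odd f], fold F_def)
    show "\<varpi> ^ (n + 1) dvd (step_diff (CARD('p) ^ n) ^^ 2) F x" for x
      by (rule step_diff_funpow2_dvd[OF log two[OF nL]])
    show "\<varpi> ^ (n + 2) dvd (step_diff (CARD('p) ^ n) ^^ 3) F x" for x
      by (rule step_diff_funpow3_dvd[OF log two[OF nL] three[OF nL]])
    show "\<varpi> ^ (n + 2) dvd (step_diff (CARD('p) ^ n) ^^ 2) F x" if p_eq: "CARD('p) = 3" for x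
    proof -
      \<comment> \<open>The extra 1 in the bound on \<open>n\<close> for \<open>p = 3\<close> leaves
        a predecessor that is still at least \<open>L\<close>, as the sharper second difference
        estimate requires.\<close>
      obtain k where k: "n = Suc k" "k \<ge> L" using n p_eq by (cases n) (auto simp: L_def)
      show ?thesis
        using step_diff_funpow2_dvd_Suc[OF log p3 two[OF k(2)] three[OF k(2)] twoS[OF k(2)], of x]
        by (simp add: k(1) numeral_3_eq_3)
    qed
  qed
qed

text \<open>The approximation holds at every level from \<open>N\<close> on, so transitivity climbs
  one power of \<open>p\<close> at a time without end.\<close>

lemma ergodic_iff_transitive_mod:
  fixes f :: "'p::prime_card padic_int \<Rightarrow> 'p padic_int"
  assumes odd: "odd CARD('p)" and f: "compatible f"
    and qa: "\<And>n. n \<ge> N \<Longrightarrow> quad_approx f n"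
  shows "ergodic f \<longleftrightarrow> transitive_mod f (N + 1)"
proof -
  have "minimal_mod f k" if min: "minimal_mod f (N + 1)" for k
  proof -
    have "minimal_mod f (n + 1)" if "n \<ge> N" for n
      using that
    proof (induction n rule: dec_induct)
      case (step n)
      then show ?case using minimal_mod_lift[OF odd f qa, of n] by simp
    qed (rule min)
    from this[of "N + k"] show ?thesis by (rule minimal_mod_antimono) auto
  qed
  then show ?thesis
    using ergodic_iff_minimal_mod[OF f] transitive_mod_iff_minimal_mod[OF f] by blast
qed

theorem theorem4p1:
  fixes f :: "'p::prime_card padic_int \<Rightarrow> 'p padic_int"
    and a :: "nat \<Rightarrow> 'p padic_int"
    and \<rho> :: nat
  assumes "odd CARD('p)"
    and "compatible f"
    and "\<And>x. (\<lambda>i. a i * padic_binom x i) sums f x"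
    and "\<And>i. padic_norm (to_fract (a i) / of_nat (fact i)) \<le> real CARD('p) ^ \<rho>"
  shows "(CARD('p) \<noteq> 3 \<longrightarrow> (ergodic f \<longleftrightarrow> transitive_mod f (lambda_bound CARD('p) \<rho> + 1))) \<and>
         (CARD('p) = 3 \<longrightarrow> (ergodic f \<longleftrightarrow> transitive_mod f (lambda_bound CARD('p) \<rho> + 2)))"
  using ergodic_iff_transitive_mod[OF assms(1,2),
      of "lambda_bound CARD('p) \<rho> + (if CARD('p) = 3 then 1 else 0)"]
    quad_approx_of_interpolation_series[OF assms] by (auto simp: numeral_2_eq_2)

end
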